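(* In the setting and notation of the context, assume that for every $b\in\mathbb{B}$ $$((\epsilon_0\otimes\ell)\rho\otimes \mathrm{id})(\pi_{\mathcal{E}}\tau_2\otimes \pi_{\mathfrak{B}})\underline{\Delta}(\mathtt{b})=(\pi_{\mathcal{E}}\tau_2\otimes \pi_{\mathfrak{B}})\underline{\Delta}(\mathtt{b})$$ and $$[\epsilon_0\pi_{\mathcal{E}}\tau_2\otimes ((\pi_{\mathcal{E}}\tau_2\otimes \pi_{\mathfrak{B}})\underline{\Delta}\tau_1)]\underline{\Delta}(\mathtt{b})=0 .$$ Let $\omega\colon\mathfrak{B}\to\mathcal{E}$ be the linear map defined on the basis $\mathbb{B}$ by $$\omega(b)=\ell(b)-(\epsilon_0\otimes\ell)(\pi_{\mathcal{E}}\tau_2\otimes \pi_{\mathfrak{B}})\underline{\Delta}(\mathtt{b}).$$ If $\omega$ is $H$-linear, then $\sigma\colon\mathfrak{B}\otimes\mathfrak{B}\to\Bbbk$, $\sigma(a,b)=\epsilon_0(\omega(a)\omega(b))$, belongs to $Z^2(\mathfrak{B})^H$, and $\mathcal{E}\simeq\mathfrak{B}_{(\sigma)}$.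
   Context: $\Bbbk$ is an algebraically closed field of characteristic zero and $H$ is a Hopf algebra over $\Bbbk$ with bijective antipode; ${}^H_H\mathcal{YD}$ is the braided category of Yetter–Drinfeld modules, with coaction $v\mapsto v_{(-1)}\otimes v_{(0)}$ and braiding $c(v\otimes w)=v_{(-1)}\cdot w\otimes v_{(0)}$. $(V,c)$ is a braided vector space with basis $x_1,\dots,x_\theta$ realized in ${}^H_H\mathcal{YD}$, and $\mathfrak{B}=\mathfrak{B}(V)$ is its Nichols algebra. Tensor products of algebras/coalgebras are braided; in particular $\mathfrak{B}\otimes\mathfrak{B}$ is a coalgebra with $\Delta(a\otimes b)=\big(a_{(1)}\otimes a_{(2)(-1)}\cdot b_{(1)}\big)\otimes\big(a_{(2)(0)}\otimes b_{(2)}\big)$, and convolution products of maps on $\mathfrak{B}\otimes\mathfrak{B}$ are taken with respect to it. Cleft objects. A (right) cleft object for $\mathfrak{B}$ in $H$-mod is a right $\mathfrak{B}$-comodule algebra $\mathcal{E}$ in $H$-mod, with coaction $\rho\colon\mathcal{E}\to\mathcal{E}\otimes\mathfrak{B}$, with coinvariants $\Bbbk$, and for which there is a convolution-invertible comodule isomorphism $\gamma\colon\mathfrak{B}\to\mathcal{E}$ in $H$-mod. A convolution-invertible comodule isomorphism $\gamma$ with $\gamma(1)=1$ is called a section. $\mathrm{Cleft}_H(\mathfrak{B})$ is the set of isoclasses of such cleft objects. Cocycles. $Z^2(\mathfrak{B})^H$ is the set of convolution-invertible linear maps $\sigma\colon\mathfrak{B}\otimes\mathfrak{B}\to\Bbbk$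 with $\sigma(h_{(1)}\cdot a,h_{(2)}\cdot b)=\epsilon(h)\sigma(a,b)$ ($H$-linearity), $\sigma(x,1)=\epsilon(x)=\sigma(1,x)$, and $\sigma(x_{(1)},y_{(1)})\sigma(x_{(2)}y_{(2)},z)=\sigma(y_{(1)},z_{(1)})\sigma(x,y_{(2)}z_{(2)})$, where $x_{(1)}\otimes y_{(1)}\otimes x_{(2)}\otimes y_{(2)}$ denotes the braided coproduct of $x\otimes y$. $\mathfrak{B}_{(\sigma)}$ is the comodule algebra with underlying space $\mathfrak{B}$, product $\sigma\ast m$ (convolution with the multiplication $m$ of $\mathfrak{B}$), and coaction $\Delta$. Fixed data. $\mathcal{E}\in\mathrm{Cleft}_H(\mathfrak{B})$ with coaction $\rho$; a pre-Nichols algebra $\hat{\mathfrak{B}}$ of $V$ (an intermediate graded braided Hopf algebra quotient $T(V)\twoheadrightarrow\hat{\mathfrak{B}}\twoheadrightarrow\mathfrak{B}$) with canonical projection $\pi_{\mathfrak{B}}\colon\hat{\mathfrak{B}}\to\mathfrak{B}$, $\mathfrak{J}=\ker\pi_{\mathfrak{B}}$; an algebra projection $\pi_{\mathcal{E}}\colon\hat{\mathfrak{B}}\to\mathcal{E}$ with $\rho\pi_{\mathcal{E}}=(\pi_{\mathcal{E}}\otimes\pi_{\mathfrak{B}})\Delta_{\hat{\mathfrak{B}}}$. The generators of $\hat{\mathfrak{B}}$ are written $\mathtt{x}_1,\dots,\mathtt{x}_\theta$ and their images in $\mathcal{E}$ are $y_1,\dots,y_\theta$. $\mathbb{B}$ is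 a homogeneous basis of $\mathfrak{B}$, whose elements are $b=p_b(x_1,\dots,x_\theta)$ for fixed homogeneous noncommutative polynomials $p_b$; the elements $p_b(y_1,\dots,y_\theta)$, $b\in\mathbb{B}$, form a basis of $\mathcal{E}$. $\ell\colon\mathfrak{B}\to\mathcal{E}$ is the linear isomorphism with $\ell(b)=p_b(y_1,\dots,y_\theta)$, and $\epsilon_0\colon\mathcal{E}\to\Bbbk$ is the linear map with $\epsilon_0\ell=\epsilon_{\mathfrak{B}}$. For $b\in\mathbb{B}$ set $\mathtt{b}=p_b(\mathtt{x}_1,\dots,\mathtt{x}_\theta)\in\hat{\mathfrak{B}}$; the linear map $\iota\colon\mathfrak{B}\to\hat{\mathfrak{B}}$, $b\mapsto\mathtt{b}$, gives $\hat{\mathfrak{B}}=\iota(\mathfrak{B})\oplus\mathfrak{J}$, with linear projections $\tau_1\colon\hat{\mathfrak{B}}\to\iota(\mathfrak{B})$ and $\tau_2\colon\hat{\mathfrak{B}}\to\mathfrak{J}$. $\underline{\Delta}(a)=\Delta(a)-a\otimes1-1\otimes a$ for homogeneous $a$ of positive degree, and $\underline{\Delta}=0$ in degree $0$. Tensor factors $\Bbbk$ are identified away ($\Bbbk\otimes X\simeq X$); e.g. $\epsilon_0\otimes\ell$ is regarded as a map $\mathcal{E}\otimes\mathfrak{B}\to\mathcal{E}$. *)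

theory Defs
  imports
    "HOL-Computational_Algebra.Polynomial"
    "HOL-Library.Function_Algebras"
    "HOL-Library.Poly_Mapping"
begin

section \<open>Vector spaces and tensor products\<close>

text \<open>
  Vector spaces live on whole types; a record carries the scalar multiplication and the
  further operations, while addition comes from the class \<open>ab_group_add\<close>.
\<close>

record ('k, 'a) vect =
  scale :: "'k \<Rightarrow> 'a \<Rightarrow> 'a"

definition vspace :: "('k::field, 'a::ab_group_add, 'm) vect_scheme \<Rightarrow> bool" where
  "vspace A \<longleftrightarrow> vector_space (scale A)"

definition lin :: "('k::field, 'a::ab_group_add, 'm) vect_scheme
    \<Rightarrow> ('k, 'b::ab_group_add, 'n) vect_scheme \<Rightarrow> ('a \<Rightarrow> 'b) \<Rightarrow> bool" where
  "lin A B f \<longleftrightarrow> Vector_Spaces.linear (scale A) (scale B) f"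

definition bilin :: "('k::field, 'a::ab_group_add, 'm) vect_scheme
    \<Rightarrow> ('k, 'b::ab_group_add, 'n) vect_scheme \<Rightarrow> ('k, 'c::ab_group_add, 'o) vect_scheme
    \<Rightarrow> ('a \<Rightarrow> 'b \<Rightarrow> 'c) \<Rightarrow> bool" where
  "bilin A B C f \<longleftrightarrow> (\<forall>a. lin B C (f a)) \<and> (\<forall>b. lin A C (\<lambda>a. f a b))"

definition vspan :: "('k::field, 'a::ab_group_add, 'm) vect_scheme \<Rightarrow> 'a set \<Rightarrow> 'a set" where
  "vspan A X = module.span (scale A) X"

definition is_subspace :: "('k::field, 'a::ab_group_add, 'm) vect_scheme \<Rightarrow> 'a set \<Rightarrow> bool" where
  "is_subspace A X \<longleftrightarrow> module.subspace (scale A) X"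

definition indep :: "('k::field, 'a::ab_group_add, 'm) vect_scheme \<Rightarrow> 'a set \<Rightarrow> bool" where
  "indep A X \<longleftrightarrow> \<not> module.dependent (scale A) X"

definition is_basis :: "('k::field, 'a::ab_group_add, 'm) vect_scheme \<Rightarrow> 'a set \<Rightarrow> bool" where
  "is_basis A X \<longleftrightarrow> indep A X \<and> vspan A X = UNIV"

definition family_basis :: "('k::field, 'a::ab_group_add, 'm) vect_scheme
    \<Rightarrow> 'i set \<Rightarrow> ('i \<Rightarrow> 'a) \<Rightarrow> bool" where
  "family_basis A I v \<longleftrightarrow> inj_on v I \<and> is_basis A (v ` I)"

definition ground :: "('k::field, 'k) vect" where
  "ground = \<lparr>scale = (*)\<rparr>"

text \<open>
  \<open>A \<otimes> B\<close> is realized inside the dual of the space of bilinear forms on \<open>A \<times> B\<close>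
  (over a field the canonical map from the tensor product to this dual is injective):
  \<open>a \<otimes> b\<close> is evaluation at \<open>(a, b)\<close>, set to zero on functions that are not bilinear, and
  \<open>A \<otimes> B\<close> is the span of the pure tensors. \<open>TT\<close> is the ambient function space; since
  bilinear forms extend from subspaces, iterated tensor products may be formed over \<open>TT\<close>
  instead of over its subspace \<open>A \<otimes> B\<close>.
\<close>

type_synonym ('k, 'a, 'b) tensor = "('a \<Rightarrow> 'b \<Rightarrow> 'k) \<Rightarrow> 'k"

definition TT :: "('k::field, ('k, 'a, 'b) tensor) vect" where
  "TT = \<lparr>scale = (\<lambda>c t \<beta>. c * t \<beta>)\<rparr>"

definition tens :: "('k::field, 'a::ab_group_add, 'm) vect_scheme
    \<Rightarrow> ('k, 'b::ab_group_add, 'n) vect_scheme \<Rightarrow> 'a \<Rightarrow> 'b \<Rightarrow> ('k, 'a, 'b) tensor" where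
  "tens A B a b = (\<lambda>\<beta>. if bilin A B ground \<beta> then \<beta> a b else 0)"

definition tspace :: "('k::field, 'a::ab_group_add, 'm) vect_scheme
    \<Rightarrow> ('k, 'b::ab_group_add, 'n) vect_scheme \<Rightarrow> ('k, 'a, 'b) tensor set" where
  "tspace A B = vspan TT {tens A B a b | a b. True}"

text \<open>
  \<open>sweedler A B t f\<close> is the value at \<open>t \<in> A \<otimes> B\<close> of the linear map induced by the bilinear
  map \<open>f\<close>, in Sweedler notation \<open>f(t\<^sub>1, t\<^sub>2)\<close>. It does not depend on the chosen
  representation of \<open>t\<close> as a sum of pure tensors (lemma \<open>sweedler_eq\<close>).
\<close>

definition sweedler :: "('k::field, 'a::ab_group_add, 'm) vect_scheme
    \<Rightarrow> ('k, 'b::ab_group_add, 'n) vect_scheme \<Rightarrow> ('k, 'a, 'b) tensor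
    \<Rightarrow> ('a \<Rightarrow> 'b \<Rightarrow> 'c::ab_group_add) \<Rightarrow> 'c" where
  "sweedler A B t f =
     (let ps = (SOME ps. t = (\<Sum>(a, b)\<leftarrow>ps. tens A B a b)) in \<Sum>(a, b)\<leftarrow>ps. f a b)"

definition tmap :: "('k::field, 'a::ab_group_add, 'm) vect_scheme
    \<Rightarrow> ('k, 'b::ab_group_add, 'n) vect_scheme
    \<Rightarrow> ('k, 'c::ab_group_add, 'o) vect_scheme \<Rightarrow> ('k, 'd::ab_group_add, 'p) vect_scheme
    \<Rightarrow> ('a \<Rightarrow> 'c) \<Rightarrow> ('b \<Rightarrow> 'd) \<Rightarrow> ('k, 'a, 'b) tensor \<Rightarrow> ('k, 'c, 'd) tensor" where
  "tmap A B C D f g t = sweedler A B t (\<lambda>a b. tens C D (f a) (g b))"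

lemma vspace_TT: "vspace TT"
  unfolding vspace_def TT_def
  by unfold_locales (auto simp: fun_eq_iff algebra_simps)

lemma vspace_ground: "vspace ground"
  unfolding vspace_def ground_def
  by unfold_locales (auto simp: algebra_simps)

lemma lin_iff:
  "lin A B f \<longleftrightarrow> vspace A \<and> vspace B \<and> (\<forall>x y. f (x + y) = f x + f y)
     \<and> (\<forall>c x. f (scale A c x) = scale B c (f x))"
  unfolding lin_def vspace_def
  by (auto simp: Vector_Spaces.linear_iff_module_hom module_hom_iff
      module_iff_vector_space)

lemma functional_separates:
  assumes "vspace C" and "c \<noteq> 0"
  obtains \<phi> where "lin C ground \<phi>" and "\<phi> c \<noteq> 0"
proof -
  interpret vector_space_pair "scale C" "scale ground"
    using assms(1) vspace_ground by (simp add: vspace_def vector_space_pair_def)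
  have "vs1.independent {c}"
    using assms(2) by simp
  from linear_independent_extend[OF this, of "\<lambda>_. 1"] obtain \<phi>
    where "Vector_Spaces.linear (scale C) (scale ground) \<phi>" "\<phi> c = 1" by auto
  then show thesis using that by (simp add: lin_def)
qed

lemma lin_sum_list: "lin A B f \<Longrightarrow> f (\<Sum>x\<leftarrow>xs. g x) = (\<Sum>x\<leftarrow>xs. f (g x))"
proof (induction xs)
  case Nil
  then have "f (0 + 0) = f 0 + f 0" unfolding lin_iff by blast
  then show ?case by simp
qed (simp add: lin_iff)

lemma sum_list_fun_apply: "(\<Sum>x\<leftarrow>xs. g x) \<beta> = (\<Sum>x\<leftarrow>xs. g x \<beta>)"
  by (induction xs) auto

lemma bilin_functional:
  assumes "bilin A B C f" and "lin C D \<phi>"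
  shows "bilin A B D (\<lambda>a b. \<phi> (f a b))"
  using assms unfolding bilin_def lin_iff by auto

lemma sweedler_eq:
  assumes "bilin A B C f" and t: "t = (\<Sum>(a, b)\<leftarrow>ps. tens A B a b)"
  shows "sweedler A B t f = (\<Sum>(a, b)\<leftarrow>ps. f a b)"
proof -
  define qs where "qs = (SOME ps. t = (\<Sum>(a, b)\<leftarrow>ps. tens A B a b))"
  have q: "t = (\<Sum>(a, b)\<leftarrow>qs. tens A B a b)"
    unfolding qs_def by (rule someI[of _ ps]) (rule t)
  have C: "vspace C" using assms(1) by (auto simp: bilin_def lin_iff)
  have "(\<Sum>(a, b)\<leftarrow>qs. f a b) = (\<Sum>(a, b)\<leftarrow>ps. f a b)"
  proof (rule ccontr)
    assume "\<not> ?thesis"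
    then have "(\<Sum>(a, b)\<leftarrow>qs. f a b) - (\<Sum>(a, b)\<leftarrow>ps. f a b) \<noteq> 0" by simp
    from functional_separates[OF C this] obtain \<phi> where \<phi>: "lin C ground \<phi>"
      and ne: "\<phi> ((\<Sum>(a, b)\<leftarrow>qs. f a b) - (\<Sum>(a, b)\<leftarrow>ps. f a b)) \<noteq> 0" .
    have ev: "\<phi> (\<Sum>(a, b)\<leftarrow>rs. f a b) = t (\<lambda>a b. \<phi> (f a b))"
      if "t = (\<Sum>(a, b)\<leftarrow>rs. tens A B a b)" for rs
      unfolding that sum_list_fun_apply lin_sum_list[OF \<phi>]
      using bilin_functional[OF assms(1) \<phi>]
      by (intro arg_cong[where f = sum_list] map_cong) (auto simp: tens_def)
    have "\<phi> (x - y) + \<phi> y = \<phi> x" for x y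
      using \<phi> unfolding lin_iff by (metis diff_add_cancel)
    with ne ev[OF q] ev[OF t] show False by (metis add_cancel_left_left)
  qed
  then show ?thesis by (simp add: sweedler_def qs_def)
qed

lemma sweedler_tens: "bilin A B C f \<Longrightarrow> sweedler A B (tens A B a b) f = f a b"
  using sweedler_eq[of A B C f "tens A B a b" "[(a, b)]"] by simp

lemma bilin_tens:
  assumes "vspace A" and "vspace B"
  shows "bilin A B TT (tens A B)"
  using assms vspace_TT
  by (auto simp: bilin_def lin_iff tens_def TT_def ground_def fun_eq_iff)

lemma tspace_iff:
  assumes "vspace A" and "vspace B"
  shows "t \<in> tspace A B \<longleftrightarrow> (\<exists>ps. t = (\<Sum>(a, b)\<leftarrow>ps. tens A B a b))"
proof -
  interpret T: vector_space "scale (TT :: ('a, ('a, 'b, 'd) tensor) vect)"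
    using vspace_TT by (simp add: vspace_def)
  note bt = bilin_tens[OF assms]
  show ?thesis
  proof
    assume "t \<in> tspace A B"
    then have "t \<in> T.span {tens A B a b | a b. True}" by (simp add: tspace_def vspan_def)
    then show "\<exists>ps. t = (\<Sum>(a, b)\<leftarrow>ps. tens A B a b)"
    proof (induction rule: T.span_induct_alt)
      case base
      show ?case by (rule exI[of _ "[]"]) simp
    next
      case (step c x y)
      then obtain a b ps where x: "x = tens A B a b" and y: "y = (\<Sum>(a, b)\<leftarrow>ps. tens A B a b)"
        by auto
      have "scale TT c x = tens A B (scale A c a) b"
        using bt unfolding x bilin_def lin_iff by simp
      then show ?case using y by (intro exI[of _ "(scale A c a, b) # ps"]) simp
    qed
  next
    assume "\<exists>ps. t = (\<Sum>(a, b)\<leftarrow>ps. tens A B a b)"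
    then obtain ps where "t = (\<Sum>(a, b)\<leftarrow>ps. tens A B a b)" ..
    moreover have "(\<Sum>(a, b)\<leftarrow>ps. tens A B a b) \<in> T.span {tens A B a b | a b. True}"
    proof (induction ps)
      case Nil
      show ?case unfolding list.map sum_list.Nil by (rule T.span_zero)
    next
      case (Cons q ps)
      obtain a b where q: "q = (a, b)" by (cases q)
      have "tens A B a b \<in> T.span {tens A B a b | a b. True}" by (rule T.span_base) blast
      from T.span_add[OF this Cons.IH] show ?case unfolding q list.map sum_list.Cons prod.case .
    qed
    ultimately show "t \<in> tspace A B" by (simp add: tspace_def vspan_def)
  qed
qed


section \<open>Algebras, coalgebras and Hopf algebras\<close>

definition assoc_algebra :: "('k::field, 'a::ab_group_add, 'm) vect_scheme
    \<Rightarrow> ('a \<Rightarrow> 'a \<Rightarrow> 'a) \<Rightarrow> 'a \<Rightarrow> bool" where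
  "assoc_algebra A m u \<longleftrightarrow>
     vspace A \<and> bilin A A A m \<and>
     (\<forall>a b c. m (m a b) c = m a (m b c)) \<and>
     (\<forall>a. m u a = a \<and> m a u = a)"

definition alg_hom :: "('k::field, 'a::ab_group_add, 'm) vect_scheme \<Rightarrow> ('a \<Rightarrow> 'a \<Rightarrow> 'a) \<Rightarrow> 'a
    \<Rightarrow> ('k, 'b::ab_group_add, 'n) vect_scheme \<Rightarrow> ('b \<Rightarrow> 'b \<Rightarrow> 'b) \<Rightarrow> 'b
    \<Rightarrow> ('a \<Rightarrow> 'b) \<Rightarrow> bool" where
  "alg_hom A m u B m' u' f \<longleftrightarrow>
     lin A B f \<and> (\<forall>a b. f (m a b) = m' (f a) (f b)) \<and> f u = u'"

definition coalgebra :: "('k::field, 'a::ab_group_add, 'm) vect_scheme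
    \<Rightarrow> ('a \<Rightarrow> ('k, 'a, 'a) tensor) \<Rightarrow> ('a \<Rightarrow> 'k) \<Rightarrow> bool" where
  "coalgebra A D e \<longleftrightarrow>
     vspace A \<and> lin A TT D \<and> (\<forall>a. D a \<in> tspace A A) \<and> lin A ground e \<and>
     (\<forall>a. sweedler A A (D a) (\<lambda>x z. sweedler A A (D x) (\<lambda>u v. tens A TT u (tens A A v z)))
        = sweedler A A (D a) (\<lambda>x z. tens A TT x (D z))) \<and>
     (\<forall>a. sweedler A A (D a) (\<lambda>x y. scale A (e x) y) = a) \<and>
     (\<forall>a. sweedler A A (D a) (\<lambda>x y. scale A (e y) x) = a)"

record ('k, 'h) hopf = "('k, 'h) vect" +
  hmul :: "'h \<Rightarrow> 'h \<Rightarrow> 'h"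
  hone :: 'h
  hcomul :: "'h \<Rightarrow> ('k, 'h, 'h) tensor"
  hcounit :: "'h \<Rightarrow> 'k"
  hantip :: "'h \<Rightarrow> 'h"

definition hopf_algebra :: "('k::field, 'h::ab_group_add) hopf \<Rightarrow> bool" where
  "hopf_algebra H \<longleftrightarrow>
     assoc_algebra H (hmul H) (hone H) \<and>
     coalgebra H (hcomul H) (hcounit H) \<and>
     (\<forall>g h. hcomul H (hmul H g h) =
        sweedler H H (hcomul H g) (\<lambda>g1 g2. sweedler H H (hcomul H h) (\<lambda>h1 h2.
          tens H H (hmul H g1 h1) (hmul H g2 h2)))) \<and>
     hcomul H (hone H) = tens H H (hone H) (hone H) \<and>
     (\<forall>g h. hcounit H (hmul H g h) = hcounit H g * hcounit H h) \<and>
     hcounit H (hone H) = 1 \<and>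
     lin H H (hantip H) \<and>
     (\<forall>h. sweedler H H (hcomul H h) (\<lambda>h1 h2. hmul H (hantip H h1) h2)
            = scale H (hcounit H h) (hone H)) \<and>
     (\<forall>h. sweedler H H (hcomul H h) (\<lambda>h1 h2. hmul H h1 (hantip H h2))
            = scale H (hcounit H h) (hone H))"


section \<open>Modules and Yetter--Drinfeld modules\<close>

record ('k, 'h, 'a) hmod = "('k, 'a) vect" +
  act :: "'h \<Rightarrow> 'a \<Rightarrow> 'a"

record ('k, 'h, 'a) ydmod = "('k, 'h, 'a) hmod" +
  coact :: "'a \<Rightarrow> ('k, 'h, 'a) tensor"

definition h_module :: "('k::field, 'h::ab_group_add) hopf
    \<Rightarrow> ('k, 'h, 'a::ab_group_add, 'm) hmod_scheme \<Rightarrow> bool" where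
  "h_module H M \<longleftrightarrow>
     vspace M \<and> bilin H M M (act M) \<and>
     (\<forall>g h v. act M (hmul H g h) v = act M g (act M h v)) \<and>
     (\<forall>v. act M (hone H) v = v)"

definition h_linear :: "('k::field, 'h::ab_group_add, 'a::ab_group_add, 'm) hmod_scheme
    \<Rightarrow> ('k, 'h, 'b::ab_group_add, 'n) hmod_scheme \<Rightarrow> ('a \<Rightarrow> 'b) \<Rightarrow> bool" where
  "h_linear M N f \<longleftrightarrow> lin M N f \<and> (\<forall>h v. f (act M h v) = act N h (f v))"

definition h_comodule :: "('k::field, 'h::ab_group_add) hopf
    \<Rightarrow> ('k, 'h, 'a::ab_group_add, 'm) ydmod_scheme \<Rightarrow> bool" where
  "h_comodule H M \<longleftrightarrow>
     vspace M \<and> lin M TT (coact M) \<and> (\<forall>v. coact M v \<in> tspace H M) \<and>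
     (\<forall>v. sweedler H M (coact M v) (\<lambda>g w. sweedler H H (hcomul H g) (\<lambda>g1 g2.
             tens H TT g1 (tens H M g2 w)))
        = sweedler H M (coact M v) (\<lambda>g w. tens H TT g (coact M w))) \<and>
     (\<forall>v. sweedler H M (coact M v) (\<lambda>g w. scale M (hcounit H g) w) = v)"

definition yd_module :: "('k::field, 'h::ab_group_add) hopf
    \<Rightarrow> ('k, 'h, 'a::ab_group_add, 'm) ydmod_scheme \<Rightarrow> bool" where
  "yd_module H M \<longleftrightarrow>
     h_module H M \<and> h_comodule H M \<and>
     (\<forall>h v. coact M (act M h v) =
        sweedler H H (hcomul H h) (\<lambda>h1 h'. sweedler H H (hcomul H h') (\<lambda>h2 h3.
          sweedler H M (coact M v) (\<lambda>g w.
            tens H M (hmul H (hmul H h1 g) (hantip H h3)) (act M h2 w)))))"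

definition yd_morphism :: "('k::field, 'h::ab_group_add) hopf
    \<Rightarrow> ('k, 'h, 'a::ab_group_add, 'm) ydmod_scheme
    \<Rightarrow> ('k, 'h, 'b::ab_group_add, 'n) ydmod_scheme \<Rightarrow> ('a \<Rightarrow> 'b) \<Rightarrow> bool" where
  "yd_morphism H M N f \<longleftrightarrow>
     h_linear M N f \<and> (\<forall>v. coact N (f v) = tmap H M H N id f (coact M v))"

definition h_module_algebra :: "('k::field, 'h::ab_group_add) hopf
    \<Rightarrow> ('k, 'h, 'a::ab_group_add, 'm) hmod_scheme \<Rightarrow> ('a \<Rightarrow> 'a \<Rightarrow> 'a) \<Rightarrow> 'a \<Rightarrow> bool" where
  "h_module_algebra H A m u \<longleftrightarrow>
     h_module H A \<and> assoc_algebra A m u \<and>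
     (\<forall>h a b. act A h (m a b) =
        sweedler H H (hcomul H h) (\<lambda>h1 h2. m (act A h1 a) (act A h2 b))) \<and>
     (\<forall>h. act A h u = scale A (hcounit H h) u)"


section \<open>Graded braided Hopf algebras\<close>

record ('k, 'h, 'a) bhopf = "('k, 'h, 'a) ydmod" +
  bmul :: "'a \<Rightarrow> 'a \<Rightarrow> 'a"
  bone :: 'a
  bcomul :: "'a \<Rightarrow> ('k, 'a, 'a) tensor"
  bcounit :: "'a \<Rightarrow> 'k"
  bantip :: "'a \<Rightarrow> 'a"
  grade :: "nat \<Rightarrow> 'a set"

text \<open>
  The braided coproduct of \<open>a \<otimes> b\<close>:
  \<open>(a\<^sub>1 \<otimes> a\<^sub>2\<^sub>(\<^sub>-\<^sub>1\<^sub>) \<cdot> b\<^sub>1) \<otimes> (a\<^sub>2\<^sub>(\<^sub>0\<^sub>) \<otimes> b\<^sub>2)\<close>, evaluated on a function of the four tensor factors.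
\<close>

definition bsweedler :: "('k::field, 'h::ab_group_add) hopf
    \<Rightarrow> ('k, 'h, 'a::ab_group_add, 'm) bhopf_scheme \<Rightarrow> 'a \<Rightarrow> 'a
    \<Rightarrow> ('a \<Rightarrow> 'a \<Rightarrow> 'a \<Rightarrow> 'a \<Rightarrow> 'c::ab_group_add) \<Rightarrow> 'c" where
  "bsweedler H B a b F =
     sweedler B B (bcomul B a) (\<lambda>a1 a2. sweedler B B (bcomul B b) (\<lambda>b1 b2.
       sweedler H B (coact B a2) (\<lambda>g a20. F a1 (act B g b1) a20 b2)))"

definition braided_hopf :: "('k::field, 'h::ab_group_add) hopf
    \<Rightarrow> ('k, 'h, 'a::ab_group_add, 'm) bhopf_scheme \<Rightarrow> bool" where
  "braided_hopf H B \<longleftrightarrow>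
     yd_module H B \<and>
     h_module_algebra H B (bmul B) (bone B) \<and>
     (\<forall>a b. coact B (bmul B a b) =
        sweedler H B (coact B a) (\<lambda>g a0. sweedler H B (coact B b) (\<lambda>h b0.
          tens H B (hmul H g h) (bmul B a0 b0)))) \<and>
     coact B (bone B) = tens H B (hone H) (bone B) \<and>
     coalgebra B (bcomul B) (bcounit B) \<and>
     (\<forall>h a. bcomul B (act B h a) =
        sweedler H H (hcomul H h) (\<lambda>h1 h2. sweedler B B (bcomul B a) (\<lambda>a1 a2.
          tens B B (act B h1 a1) (act B h2 a2)))) \<and>
     (\<forall>h a. bcounit B (act B h a) = hcounit H h * bcounit B a) \<and>
     (\<forall>a. sweedler H B (coact B a) (\<lambda>g a0. tens H TT g (bcomul B a0)) =
        sweedler B B (bcomul B a) (\<lambda>a1 a2. sweedler H B (coact B a1) (\<lambda>g a10.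
          sweedler H B (coact B a2) (\<lambda>h a20. tens H TT (hmul H g h) (tens B B a10 a20))))) \<and>
     (\<forall>a. sweedler H B (coact B a) (\<lambda>g a0. scale H (bcounit B a0) g)
        = scale H (bcounit B a) (hone H)) \<and>
     (\<forall>a b. bcomul B (bmul B a b) =
        bsweedler H B a b (\<lambda>a1 b1 a2 b2. tens B B (bmul B a1 b1) (bmul B a2 b2))) \<and>
     bcomul B (bone B) = tens B B (bone B) (bone B) \<and>
     (\<forall>a b. bcounit B (bmul B a b) = bcounit B a * bcounit B b) \<and>
     bcounit B (bone B) = 1 \<and>
     yd_morphism H B B (bantip B) \<and>
     (\<forall>a. sweedler B B (bcomul B a) (\<lambda>a1 a2. bmul B (bantip B a1) a2)
            = scale B (bcounit B a) (bone B)) \<and>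
     (\<forall>a. sweedler B B (bcomul B a) (\<lambda>a1 a2. bmul B a1 (bantip B a2))
            = scale B (bcounit B a) (bone B))"

definition graded_braided_hopf :: "('k::field, 'h::ab_group_add) hopf
    \<Rightarrow> ('k, 'h, 'a::ab_group_add, 'm) bhopf_scheme \<Rightarrow> bool" where
  "graded_braided_hopf H B \<longleftrightarrow>
     braided_hopf H B \<and>
     (\<forall>n. is_subspace B (grade B n)) \<and>
     (\<forall>a. \<exists>!f. (\<forall>n. f n \<in> grade B n) \<and> finite {n. f n \<noteq> 0} \<and> a = (\<Sum>n | f n \<noteq> 0. f n)) \<and>
     (\<forall>n h. \<forall>a\<in>grade B n. act B h a \<in> grade B n) \<and>
     (\<forall>n. \<forall>a\<in>grade B n. coact B a \<in> vspan TT {tens H B g b | g b. b \<in> grade B n}) \<and>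
     (\<forall>i j. \<forall>a\<in>grade B i. \<forall>b\<in>grade B j. bmul B a b \<in> grade B (i + j)) \<and>
     bone B \<in> grade B 0 \<and>
     (\<forall>n. \<forall>a\<in>grade B n. bcomul B a \<in>
        vspan TT {tens B B b c | b c i j. i + j = n \<and> b \<in> grade B i \<and> c \<in> grade B j}) \<and>
     (\<forall>n>0. \<forall>a\<in>grade B n. bcounit B a = 0) \<and>
     (\<forall>n. \<forall>a\<in>grade B n. bantip B a \<in> grade B n)"

definition graded_bhopf_hom :: "('k::field, 'h::ab_group_add) hopf
    \<Rightarrow> ('k, 'h, 'a::ab_group_add, 'm) bhopf_scheme
    \<Rightarrow> ('k, 'h, 'b::ab_group_add, 'n) bhopf_scheme \<Rightarrow> ('a \<Rightarrow> 'b) \<Rightarrow> bool" where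
  "graded_bhopf_hom H A B f \<longleftrightarrow>
     yd_morphism H A B f \<and>
     alg_hom A (bmul A) (bone A) B (bmul B) (bone B) f \<and>
     (\<forall>a. bcomul B (f a) = tmap A A B B f f (bcomul A a)) \<and>
     (\<forall>a. bcounit B (f a) = bcounit A a) \<and>
     (\<forall>a. f (bantip A a) = bantip B (f a)) \<and>
     (\<forall>n. f ` grade A n \<subseteq> grade B n)"

definition primitives :: "('k::field, 'h::ab_group_add, 'a::ab_group_add, 'm) bhopf_scheme
    \<Rightarrow> 'a set" where
  "primitives B = {a. bcomul B a = tens B B a (bone B) + tens B B (bone B) a}"

definition generated_by :: "('k::field, 'h::ab_group_add, 'a::ab_group_add, 'm) bhopf_scheme
    \<Rightarrow> 'a set \<Rightarrow> bool" where
  "generated_by B X \<longleftrightarrow>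
     (\<forall>S. is_subspace B S \<and> bone B \<in> S \<and> (\<forall>a\<in>S. \<forall>b\<in>S. bmul B a b \<in> S) \<and> X \<subseteq> S
        \<longrightarrow> S = UNIV)"

text \<open>
  Nichols algebra of \<open>V\<close>: a connected graded Hopf algebra in Yetter--Drinfeld modules, with
  \<open>j\<close> identifying \<open>V\<close> with the degree one part, which generates it and consists of all
  primitive elements.
\<close>

definition nichols_algebra :: "('k::field, 'h::ab_group_add) hopf
    \<Rightarrow> ('k, 'h, 'v::ab_group_add, 'm) ydmod_scheme
    \<Rightarrow> ('k, 'h, 'b::ab_group_add, 'n) bhopf_scheme \<Rightarrow> ('v \<Rightarrow> 'b) \<Rightarrow> bool" where
  "nichols_algebra H V B j \<longleftrightarrow>
     graded_braided_hopf H B \<and>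
     grade B 0 = vspan B {bone B} \<and>
     yd_morphism H V B j \<and> inj j \<and> range j = grade B 1 \<and>
     primitives B = grade B 1 \<and>
     generated_by B (grade B 1)"

text \<open>
  Tensor algebra of \<open>V\<close>, for a basis \<open>x 1, \<dots>, x \<theta>\<close> of \<open>V\<close>: the words of length \<open>n\<close> in the
  basis form a basis of the degree \<open>n\<close> part \<open>V \<otimes> \<dots> \<otimes> V\<close>, and \<open>V\<close> is primitive.
\<close>

definition tensor_algebra :: "('k::field, 'h::ab_group_add) hopf
    \<Rightarrow> ('k, 'h, 'v::ab_group_add, 'm) ydmod_scheme \<Rightarrow> nat \<Rightarrow> (nat \<Rightarrow> 'v)
    \<Rightarrow> ('k, 'h, 't::ab_group_add, 'n) bhopf_scheme \<Rightarrow> ('v \<Rightarrow> 't) \<Rightarrow> bool" where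
  "tensor_algebra H V \<theta> x T j \<longleftrightarrow>
     graded_braided_hopf H T \<and>
     yd_morphism H V T j \<and> range j \<subseteq> primitives T \<and>
     (let word = (\<lambda>w. foldr (\<lambda>i. bmul T (j (x i))) w (bone T)) in
        family_basis T {w. set w \<subseteq> {1..\<theta>}} word \<and>
        (\<forall>n. grade T n = vspan T (word ` {w. set w \<subseteq> {1..\<theta>} \<and> length w = n})))"

definition pre_nichols :: "('k::field, 'h::ab_group_add) hopf
    \<Rightarrow> ('k, 'h, 't::ab_group_add, 'm) bhopf_scheme \<Rightarrow> ('v \<Rightarrow> 't)
    \<Rightarrow> ('k, 'h, 'b::ab_group_add, 'n) bhopf_scheme \<Rightarrow> ('v \<Rightarrow> 'b)
    \<Rightarrow> ('k, 'h, 'a::ab_group_add, 'o) bhopf_scheme \<Rightarrow> ('t \<Rightarrow> 'a) \<Rightarrow> ('a \<Rightarrow> 'b) \<Rightarrow> bool" where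
  "pre_nichols H T jT B jB A q \<pi> \<longleftrightarrow>
     graded_braided_hopf H A \<and>
     graded_bhopf_hom H T A q \<and> surj q \<and>
     graded_bhopf_hom H A B \<pi> \<and> surj \<pi> \<and>
     (\<forall>v. \<pi> (q (jT v)) = jB v)"

definition reduced_comul :: "('k::field, 'h::ab_group_add, 'a::ab_group_add, 'm) bhopf_scheme
    \<Rightarrow> ('a \<Rightarrow> ('k, 'a, 'a) tensor) \<Rightarrow> bool" where
  "reduced_comul A D \<longleftrightarrow>
     lin A TT D \<and>
     (\<forall>n>0. \<forall>a\<in>grade A n. D a = bcomul A a - tens A A a (bone A) - tens A A (bone A) a) \<and>
     (\<forall>a\<in>grade A 0. D a = 0)"


section \<open>Noncommutative polynomials\<close>

type_synonym 'k ncpoly = "nat list \<Rightarrow>\<^sub>0 'k"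

definition nc_homogeneous :: "nat \<Rightarrow> nat \<Rightarrow> 'k::field ncpoly \<Rightarrow> bool" where
  "nc_homogeneous \<theta> n p \<longleftrightarrow> (\<forall>w\<in>Poly_Mapping.keys p. set w \<subseteq> {1..\<theta>} \<and> length w = n)"

definition nc_eval :: "('k::field, 'a::ab_group_add, 'm) vect_scheme
    \<Rightarrow> ('a \<Rightarrow> 'a \<Rightarrow> 'a) \<Rightarrow> 'a \<Rightarrow> (nat \<Rightarrow> 'a) \<Rightarrow> 'k ncpoly \<Rightarrow> 'a" where
  "nc_eval A m u z p =
     (\<Sum>w\<in>Poly_Mapping.keys p. scale A (Poly_Mapping.lookup p w) (foldr (\<lambda>i. m (z i)) w u))"


section \<open>Cleft objects and cocycles\<close>

record ('k, 'h, 'e, 'b) comod_alg = "('k, 'h, 'e) hmod" +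
  cmul :: "'e \<Rightarrow> 'e \<Rightarrow> 'e"
  cone :: 'e
  rho :: "'e \<Rightarrow> ('k, 'e, 'b) tensor"

definition comodule_algebra :: "('k::field, 'h::ab_group_add) hopf
    \<Rightarrow> ('k, 'h, 'b::ab_group_add, 'm) bhopf_scheme
    \<Rightarrow> ('k, 'h, 'e::ab_group_add, 'b) comod_alg \<Rightarrow> bool" where
  "comodule_algebra H B E \<longleftrightarrow>
     h_module_algebra H E (cmul E) (cone E) \<and>
     lin E TT (rho E) \<and> (\<forall>e. rho E e \<in> tspace E B) \<and>
     (\<forall>e. sweedler E B (rho E e) (\<lambda>e' c. sweedler E B (rho E e') (\<lambda>e0 b.
             tens E TT e0 (tens B B b c)))
        = sweedler E B (rho E e) (\<lambda>e0 b. tens E TT e0 (bcomul B b))) \<and>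
     (\<forall>e. sweedler E B (rho E e) (\<lambda>e0 b. scale E (bcounit B b) e0) = e) \<and>
     (\<forall>h e. rho E (act E h e) =
        sweedler H H (hcomul H h) (\<lambda>h1 h2. sweedler E B (rho E e) (\<lambda>e0 b.
          tens E B (act E h1 e0) (act B h2 b)))) \<and>
     \<comment> \<open>the product of \<open>E \<otimes> B\<close> uses the braiding \<open>b \<otimes> e \<mapsto> b\<^sub>(\<^sub>-\<^sub>1\<^sub>) \<cdot> e \<otimes> b\<^sub>(\<^sub>0\<^sub>)\<close>\<close>
     (\<forall>d e. rho E (cmul E d e) =
        sweedler E B (rho E d) (\<lambda>d0 d1. sweedler E B (rho E e) (\<lambda>e0 e1.
          sweedler H B (coact B d1) (\<lambda>g d10.
            tens E B (cmul E d0 (act E g e0)) (bmul B d10 e1))))) \<and>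
     rho E (cone E) = tens E B (cone E) (bone B)"

definition coinvariants :: "('k::field, 'h::ab_group_add, 'b::ab_group_add, 'm) bhopf_scheme
    \<Rightarrow> ('k, 'h, 'e::ab_group_add, 'b) comod_alg \<Rightarrow> 'e set" where
  "coinvariants B E = {e. rho E e = tens E B e (bone B)}"

definition conv_invertible :: "('k::field, 'h::ab_group_add, 'b::ab_group_add, 'm) bhopf_scheme
    \<Rightarrow> ('k, 'h, 'e::ab_group_add, 'b) comod_alg \<Rightarrow> ('b \<Rightarrow> 'e) \<Rightarrow> bool" where
  "conv_invertible B E \<gamma> \<longleftrightarrow>
     (\<exists>\<gamma>'. lin B E \<gamma>' \<and>
        (\<forall>b. sweedler B B (bcomul B b) (\<lambda>b1 b2. cmul E (\<gamma> b1) (\<gamma>' b2))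
               = scale E (bcounit B b) (cone E)) \<and>
        (\<forall>b. sweedler B B (bcomul B b) (\<lambda>b1 b2. cmul E (\<gamma>' b1) (\<gamma> b2))
               = scale E (bcounit B b) (cone E)))"

definition cleft_object :: "('k::field, 'h::ab_group_add) hopf
    \<Rightarrow> ('k, 'h, 'b::ab_group_add, 'm) bhopf_scheme
    \<Rightarrow> ('k, 'h, 'e::ab_group_add, 'b) comod_alg \<Rightarrow> bool" where
  "cleft_object H B E \<longleftrightarrow>
     comodule_algebra H B E \<and>
     coinvariants B E = vspan E {cone E} \<and>
     (\<exists>\<gamma>. h_linear B E \<gamma> \<and> bij \<gamma> \<and>
          (\<forall>b. rho E (\<gamma> b) = tmap B B E B \<gamma> id (bcomul B b)) \<and>
          conv_invertible B E \<gamma>)"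

definition comod_alg_iso :: "('k::field, 'h::ab_group_add, 'b::ab_group_add, 'm) bhopf_scheme
    \<Rightarrow> ('k, 'h, 'e::ab_group_add, 'b) comod_alg
    \<Rightarrow> ('k, 'h, 'f::ab_group_add, 'b) comod_alg \<Rightarrow> bool" where
  "comod_alg_iso B E F \<longleftrightarrow>
     (\<exists>f. h_linear E F f \<and> bij f \<and>
          alg_hom E (cmul E) (cone E) F (cmul F) (cone F) f \<and>
          (\<forall>e. rho F (f e) = tmap E B F B f id (rho E e)))"

text \<open>Linear maps \<open>B \<otimes> B \<rightarrow> k\<close> are given as bilinear forms.\<close>

definition Z2 :: "('k::field, 'h::ab_group_add) hopf
    \<Rightarrow> ('k, 'h, 'b::ab_group_add, 'm) bhopf_scheme \<Rightarrow> ('b \<Rightarrow> 'b \<Rightarrow> 'k) set" where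
  "Z2 H B = {\<sigma>.
     bilin B B ground \<sigma> \<and>
     (\<exists>\<sigma>'. bilin B B ground \<sigma>' \<and>
        (\<forall>a b. bsweedler H B a b (\<lambda>a1 b1 a2 b2. \<sigma> a1 b1 * \<sigma>' a2 b2)
                 = bcounit B a * bcounit B b) \<and>
        (\<forall>a b. bsweedler H B a b (\<lambda>a1 b1 a2 b2. \<sigma>' a1 b1 * \<sigma> a2 b2)
                 = bcounit B a * bcounit B b)) \<and>
     (\<forall>h a b. sweedler H H (hcomul H h) (\<lambda>h1 h2. \<sigma> (act B h1 a) (act B h2 b))
                 = hcounit H h * \<sigma> a b) \<and>
     (\<forall>x. \<sigma> x (bone B) = bcounit B x \<and> \<sigma> (bone B) x = bcounit B x) \<and>
     (\<forall>x y z. bsweedler H B x y (\<lambda>x1 y1 x2 y2. \<sigma> x1 y1 * \<sigma> (bmul B x2 y2) z)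
            = bsweedler H B y z (\<lambda>y1 z1 y2 z2. \<sigma> y1 z1 * \<sigma> x (bmul B y2 z2)))}"

definition cocycle_twist :: "('k::field, 'h::ab_group_add) hopf
    \<Rightarrow> ('k, 'h, 'b::ab_group_add, 'm) bhopf_scheme \<Rightarrow> ('b \<Rightarrow> 'b \<Rightarrow> 'k)
    \<Rightarrow> ('k, 'h, 'b, 'b) comod_alg" where
  "cocycle_twist H B \<sigma> =
     \<lparr>scale = scale B, act = act B,
      cmul = (\<lambda>a b. bsweedler H B a b (\<lambda>a1 b1 a2 b2. scale B (\<sigma> a1 b1) (bmul B a2 b2))),
      cone = bone B, rho = bcomul B\<rparr>"

end

theory Submission
  imports Defs
begin

text \<open>
  Write \<open>D b = \<rho> (\<ell> b) - (\<ell> \<otimes> id) (\<Delta> b)\<close> for the failure of \<open>\<ell>\<close> to be colinear,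
  \<open>M = (\<epsilon>\<^sub>0 \<otimes> id) \<rho>\<close>, which is colinear, and \<open>n = M \<ell> - id\<close>. Since
  \<open>\<pi>\<^sub>E \<tau>\<^sub>2 = \<pi>\<^sub>E - \<ell> \<pi>\<^sub>B\<close> vanishes on \<open>\<iota> B\<close>, the tensor
  \<open>(\<pi>\<^sub>E \<tau>\<^sub>2 \<otimes> \<pi>\<^sub>B) \<Delta>\<close> of \<open>\<iota> b\<close>, reduced or not, is \<open>D b\<close>. Hence the two conditions
  say \<open>(\<ell> M \<otimes> id) D = D\<close> and \<open>D n = 0\<close>, and \<open>\<omega> = \<ell> (id - n)\<close>. The first gives
  \<open>D = (\<ell> \<otimes> id) (\<Delta> n - (n \<otimes> id) \<Delta>)\<close>; together with the second, \<open>\<omega>\<close> is colinear. Applying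
  \<open>\<epsilon>\<^sub>0 \<otimes> id\<close> to \<open>D n = 0\<close> gives \<open>n\<^sup>2 = 0\<close>, so \<open>\<omega>\<close> is bijective. It differs from a convolution
  invertible section by a convolution invertible form on \<open>B\<close>, so it is a section itself.

  For a section \<open>\<omega>\<close> with \<open>\<epsilon>\<^sub>0 \<omega> = \<epsilon>\<close>, colinearity turns \<open>\<omega> a \<cdot> \<omega> b\<close> into
  \<open>\<omega>\<close> of the product \<open>\<sigma> * m\<close>; the cocycle identity is \<open>\<epsilon>\<^sub>0\<close> of associativity in \<open>E\<close>.
  The form \<open>\<sigma>\<close>, read in the braided convolution algebra of maps \<open>B \<otimes> B \<rightarrow> E\<close>, is the quotient of
  \<open>m\<^sub>E (\<omega> \<otimes> \<omega>)\<close> by \<open>\<omega> m\<close>, both of which are invertible.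
\<close>

section \<open>Linear maps and Sweedler sums\<close>

lemma lin_add: "lin A B f \<Longrightarrow> f (x + y) = f x + f y"
  and lin_scale: "lin A B f \<Longrightarrow> f (scale A c x) = scale B c (f x)"
  by (auto simp: lin_iff)

lemma lin_zero: "lin A B f \<Longrightarrow> f 0 = 0"
  using lin_add[of A B f 0 0] by simp

lemma lin_diff: "lin A B f \<Longrightarrow> f (x - y) = f x - f y"
  using lin_add[of A B f "x - y" y] by simp

lemma lin_compose: "lin A B f \<Longrightarrow> lin X A g \<Longrightarrow> lin X B (\<lambda>x. f (g x))"
  by (simp add: lin_iff)

lemma lin_ident: "vspace A \<Longrightarrow> lin A A (\<lambda>x. x)"
  by (simp add: lin_iff)

lemma lin_scale_right:
  assumes "lin X A g" shows "lin X A (\<lambda>x. scale A c (g x))"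
proof -
  interpret vector_space "scale A" using assms by (simp add: lin_iff vspace_def)
  show ?thesis using assms by (auto simp: lin_iff scale_right_distrib mult.commute)
qed

lemma lin_scale_left:
  assumes "vspace A" "lin X ground g" shows "lin X A (\<lambda>x. scale A (g x) a)"
proof -
  interpret vector_space "scale A" using assms(1) by (simp add: vspace_def)
  show ?thesis using assms by (auto simp: lin_iff scale_left_distrib ground_def)
qed

lemma lin_times_right: "lin X ground g \<Longrightarrow> lin X ground (\<lambda>x. c * g x)"
  using lin_scale_right[of X ground g c] by (simp add: ground_def)

lemma lin_times_left: "lin X ground g \<Longrightarrow> lin X ground (\<lambda>x. g x * c)"
  using lin_times_right[of X g c] by (simp add: mult.commute)

lemma lin_sub:
  assumes "lin X A f" "lin X A g" shows "lin X A (\<lambda>x. f x - g x)"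
proof -
  interpret vector_space "scale A" using assms(1) by (simp add: lin_iff vspace_def)
  show ?thesis using assms by (auto simp: lin_iff scale_right_diff_distrib)
qed

lemma scale_scale: "vspace A \<Longrightarrow> scale A a (scale A b x) = scale A (a * b) x"
  and scale_one: "vspace A \<Longrightarrow> scale A 1 x = x"
  by (auto simp: vspace_def vector_space.vector_space_assms)

lemma bilinI:
  "(\<And>a. lin B C (f a)) \<Longrightarrow> (\<And>b. lin A C (\<lambda>a. f a b)) \<Longrightarrow> bilin A B C f"
  by (simp add: bilin_def)

lemma bilin_lin_right: "bilin A B C f \<Longrightarrow> lin X B g \<Longrightarrow> lin X C (\<lambda>x. f a (g x))"
  and bilin_lin_left: "bilin A B C f \<Longrightarrow> lin X A g' \<Longrightarrow> lin X C (\<lambda>x. f (g' x) b)"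
  using lin_compose[of B C "f a" X g] lin_compose[of A C "\<lambda>a. f a b" X g']
  by (auto simp: bilin_def)

lemma lin_eq_on_basis:
  assumes "is_basis A S" "lin A C f" "lin A C g" "\<And>b. b \<in> S \<Longrightarrow> f b = g b"
  shows "f x = g x"
proof -
  interpret vector_space_pair "scale A" "scale C"
    using assms(2) by (simp add: lin_iff vspace_def vector_space_pair_def)
  show ?thesis
    using linear_eq_on[of f g x S] assms by (simp add: lin_def is_basis_def vspan_def)
qed

lemma bij_on_family_basis:
  assumes "is_basis A S" "lin A C f" "inj_on f S" "is_basis C (f ` S)"
  shows "bij f"
proof -
  interpret vector_space_pair "scale A" "scale C"
    using assms(2) by (simp add: lin_iff vspace_def vector_space_pair_def)
  have l: "Vector_Spaces.linear (scale A) (scale C) f" using assms(2) by (simp add: lin_def)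
  have "inj_on f (vs1.span S)"
    using linear_inj_on_span_iff_independent_image[OF l, of S] assms
        by (simp add: is_basis_def indep_def)
  moreover have "f ` vs1.span S = vs2.span (f ` S)"
    by (rule linear_span_image[OF l, symmetric])
  ultimately show ?thesis using assms by (auto simp: bij_def is_basis_def vspan_def)
qed

section \<open>Calculus of Sweedler sums\<close>

definition tensor_rep :: "('k::field, 'a::ab_group_add, 'm) vect_scheme
    \<Rightarrow> ('k, 'b::ab_group_add, 'n) vect_scheme \<Rightarrow> ('k, 'a, 'b) tensor \<Rightarrow> ('a \<times> 'b) list" where
  "tensor_rep A B t = (SOME ps. t = (\<Sum>(a, b)\<leftarrow>ps. tens A B a b))"

text \<open>The list is chosen from \<open>t\<close> alone, before \<open>f\<close> is known. Rules
  that change only \<open>f\<close> hold for arbitrary functions; bilinearity matters only when the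
  tensor itself is rewritten.\<close>

lemma sweedler_rep: "sweedler A B t f = (\<Sum>(a, b)\<leftarrow>tensor_rep A B t. f a b)"
  by (simp add: sweedler_def tensor_rep_def Let_def)

lemma tspace_rep:
  assumes "vspace A" "vspace B" "t \<in> tspace A B"
  shows "t = (\<Sum>(a, b)\<leftarrow>tensor_rep A B t. tens A B a b)"
  unfolding tensor_rep_def by (rule someI_ex) (use assms in \<open>simp add: tspace_iff\<close>)

lemma sweedler_same:
  assumes "vspace A" "vspace B" "t \<in> tspace A B" shows "sweedler A B t (tens A B) = t"
  unfolding sweedler_rep by (rule tspace_rep[OF assms, symmetric])

lemma lin_sweedler: "lin C D \<phi> \<Longrightarrow> \<phi> (sweedler A B t f) = sweedler A B t (\<lambda>a b. \<phi> (f a b))"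
  unfolding sweedler_rep by (subst lin_sum_list) (auto simp: case_prod_unfold)

lemma lin_sweedler_param:
  assumes "\<And>a b. lin C D (\<lambda>c. f c a b)"
  shows "lin C D (\<lambda>c. sweedler A B t (f c))"
proof -
  have "vspace D" "vspace C" using assms by (auto simp: lin_iff)
  interpret vector_space "scale D" using \<open>vspace D\<close> by (simp add: vspace_def)
  have "lin C D (\<lambda>c. \<Sum>(a, b)\<leftarrow>ps. f c a b)" for ps
    using assms \<open>vspace D\<close> \<open>vspace C\<close>
    by (induction ps) (auto simp: lin_iff algebra_simps scale_right_distrib)
  then show ?thesis unfolding sweedler_rep .
qed

text \<open>The two chosen lists do not depend on each other, so this is an exchange of finite sums
  and rewrites without side conditions.\<close>

lemma sweedler_commute:
  "sweedler A B t (\<lambda>a b. sweedler C D s (f a b))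
      = sweedler C D s (\<lambda>c d. sweedler A B t (\<lambda>a b. f a b c d))"
proof -
  have "(\<Sum>x\<leftarrow>ps. \<Sum>y\<leftarrow>qs. g x y) = (\<Sum>y\<leftarrow>qs. \<Sum>x\<leftarrow>ps. g x y)"
    for ps :: "'x list" and qs :: "'y list" and g :: "'x \<Rightarrow> 'y \<Rightarrow> 'z::comm_monoid_add"
    by (induction ps) (auto simp: sum_list_addf)
  then show ?thesis by (simp add: sweedler_rep case_prod_unfold)
qed

lemma sweedler_diff:
  "sweedler A B t (\<lambda>a b. f a b - g a b) = sweedler A B t f - sweedler A B t g"
  by (simp add: sweedler_rep case_prod_unfold sum_list_subtractf)

lemma tens_in_tspace: "vspace A \<Longrightarrow> vspace B \<Longrightarrow> tens A B a b \<in> tspace A B"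
  by (subst tspace_iff) (auto intro: exI[of _ "[(a, b)]"])

lemma is_subspace_tspace: "is_subspace TT (tspace A B)"
proof -
  interpret vector_space "scale TT" using vspace_TT by (simp add: vspace_def)
  show ?thesis by (simp add: is_subspace_def tspace_def vspan_def)
qed

lemma tspace_add: "s \<in> tspace A B \<Longrightarrow> t \<in> tspace A B \<Longrightarrow> s + t \<in> tspace A B"
  and tspace_zero: "0 \<in> tspace A B"
  and tspace_diff: "s \<in> tspace A B \<Longrightarrow> t \<in> tspace A B \<Longrightarrow> s - t \<in> tspace A B"
proof -
  interpret vector_space "scale TT" using vspace_TT by (simp add: vspace_def)
  show "s \<in> tspace A B \<Longrightarrow> t \<in> tspace A B \<Longrightarrow> s + t \<in> tspace A B" "0 \<in> tspace A B"
    "s \<in> tspace A B \<Longrightarrow> t \<in> tspace A B \<Longrightarrow> s - t \<in> tspace A B"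
    unfolding tspace_def vspan_def by (auto intro: span_add span_zero span_diff)
qed

lemma tspace_sweedler:
  assumes "\<And>c d. G c d \<in> tspace A B" shows "sweedler C D t G \<in> tspace A B"
proof -
  have "(\<Sum>(c, d)\<leftarrow>ps. G c d) \<in> tspace A B" for ps
    using assms by (induction ps) (auto intro: tspace_add tspace_zero simp: case_prod_unfold)
  then show ?thesis by (simp add: sweedler_rep)
qed

lemma bilin_dom: "bilin A B C f \<Longrightarrow> vspace A" "bilin A B C f \<Longrightarrow> vspace B"
    "bilin A B C f \<Longrightarrow> vspace C"
  by (auto simp: bilin_def lin_iff)

text \<open>Concatenated representatives of \<open>s\<close> and \<open>t\<close> represent
  \<open>s + t\<close>; bilinearity of \<open>F\<close> makes the list actually chosen for
  \<open>s + t\<close> give the same value.\<close>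

lemma sweedler_plus:
  assumes F: "bilin A B C F" and s: "s \<in> tspace A B" and t: "t \<in> tspace A B"
  shows "sweedler A B (s + t) F = sweedler A B s F + sweedler A B t F"
proof -
  have "s + t = (\<Sum>(a, b)\<leftarrow>tensor_rep A B s @ tensor_rep A B t. tens A B a b)"
    unfolding map_append sum_list_append
    by (intro arg_cong2[where f = plus] tspace_rep bilin_dom[OF F] s t)
  from sweedler_eq[OF F this] show ?thesis by (simp add: sweedler_rep)
qed

text \<open>The scalar is absorbed into the left factors of a representative of
  \<open>t\<close>.\<close>

lemma sweedler_scale:
  assumes F: "bilin A B C F" and t: "t \<in> tspace A B"
  shows "sweedler A B (scale TT c t) F = scale C c (sweedler A B t F)"
proof -
  have AB: "vspace A" "vspace B" using bilin_dom[OF F] by auto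
  have "scale TT c t = scale TT c (\<Sum>(a, b)\<leftarrow>tensor_rep A B t. tens A B a b)"
    by (rule arg_cong[OF tspace_rep[OF AB t]])
  also have "\<dots> = (\<Sum>(a, b)\<leftarrow>tensor_rep A B t. tens A B (scale A c a) b)"
    using bilin_tens[OF AB] by (simp add: case_prod_unfold bilin_def lin_iff
      lin_sum_list[OF lin_scale_right[OF lin_ident[OF vspace_TT]]])
  also have "\<dots> = (\<Sum>(a, b)\<leftarrow>map (\<lambda>(a,b). (scale A c a, b)) (tensor_rep A B t). tens A B a b)"
    by (simp add: case_prod_unfold comp_def)
  finally have *: "sweedler A B (scale TT c t) F
      = (\<Sum>(a, b)\<leftarrow>map (\<lambda>(a,b). (scale A c a, b)) (tensor_rep A B t). F a b)"
    by (rule sweedler_eq[OF F])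
  show ?thesis unfolding *
    using F by (simp add: case_prod_unfold comp_def sweedler_rep bilin_def lin_iff
      lin_sum_list[OF lin_scale_right[OF lin_ident[OF bilin_dom(3)[OF F]]]])
qed

lemma sweedler_minus:
  assumes F: "bilin A B C F" and s: "s \<in> tspace A B" and t: "t \<in> tspace A B"
  shows "sweedler A B (s - t) F = sweedler A B s F - sweedler A B t F"
  using sweedler_plus[OF F tspace_diff[OF s t] t] by simp

lemma lin_sweedler_tensor:
  assumes "lin C TT D" "\<And>c. D c \<in> tspace A B" "bilin A B E F"
  shows "lin C E (\<lambda>c. sweedler A B (D c) F)"
  using assms lin_add[OF assms(1)] lin_scale[OF assms(1)]
  by (simp add: lin_iff sweedler_plus[OF assms(3)] sweedler_scale[OF assms(3)] bilin_dom[OF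
    assms(3)])

text \<open>This turns axioms stated as equalities of tensors into rules for nested Sweedler
  sums.\<close>

lemma sweedler_bind:
  assumes F: "bilin A B X F" and G: "\<And>c d. G c d \<in> tspace A B"
  shows "sweedler A B (sweedler C D t G) F = sweedler C D t (\<lambda>c d. sweedler A B (G c d) F)"
proof -
  have AB: "vspace A" "vspace B" using bilin_dom[OF F] by auto
  have z: "sweedler A B 0 F = 0"
    using sweedler_eq[OF F, of 0 "[]"] by simp
  have "(\<Sum>(c, d)\<leftarrow>ps. G c d) \<in> tspace A B \<and>
    sweedler A B (\<Sum>(c, d)\<leftarrow>ps. G c d) F = (\<Sum>(c, d)\<leftarrow>ps. sweedler A B (G c d) F)" for ps
    using G by (induction ps)
      (auto simp: sweedler_plus[OF F] tspace_add tspace_zero z case_prod_unfold)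
  then show ?thesis by (simp add: sweedler_rep[of C D])
qed

text \<open>Every subspace of a vector space is a direct summand, so the inclusion of
  \<open>tspace A B\<close> into the ambient function space has a linear retraction.\<close>

lemma tensor_projection:
  obtains pr :: "('k::field, 'a::ab_group_add, 'b::ab_group_add) tensor \<Rightarrow> ('k, 'a, 'b) tensor"
  where "lin TT TT pr" "\<And>t. pr t \<in> tspace A B" "\<And>t. t \<in> tspace A B \<Longrightarrow> pr t = t"
proof -
  interpret vector_space_pair "scale (TT :: ('k, ('k, 'a, 'b) tensor) vect)"
      "scale (TT :: ('k, ('k, 'a, 'b) tensor) vect)"
    using vspace_TT by (simp add: vspace_def vector_space_pair_def)
  have "Vector_Spaces.linear (scale TT) (scale TT) (\<lambda>x::('k, 'a, 'b) tensor. x)"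
    using lin_ident[OF vspace_TT] by (simp add: lin_def)
  from linear_exists_left_inverse_on[OF this, of "tspace A B"] is_subspace_tspace[of A B]
  obtain g where "range g \<subseteq> tspace A B" "Vector_Spaces.linear (scale TT) (scale TT) g"
    "\<forall>v\<in>tspace A B. g v = v" by (auto simp: is_subspace_def)
  then show thesis by (intro that[of g]) (auto simp: lin_def)
qed

definition trilin :: "('k::field, 'a::ab_group_add, 'm) vect_scheme
    \<Rightarrow> ('k, 'b::ab_group_add, 'n) vect_scheme \<Rightarrow> ('k, 'c::ab_group_add, 'o) vect_scheme
    \<Rightarrow> ('k, 'd::ab_group_add, 'p) vect_scheme \<Rightarrow> ('a \<Rightarrow> 'b \<Rightarrow> 'c \<Rightarrow> 'd) \<Rightarrow> bool" where
  "trilin A B C D F \<longleftrightarrow> (\<forall>a. bilin B C D (F a)) \<and> (\<forall>b c. lin A D (\<lambda>a. F a b c))"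

lemma trilinI:
  "(\<And>a b. lin C D (F a b)) \<Longrightarrow> (\<And>a c. lin B D (\<lambda>b. F a b c)) \<Longrightarrow> (\<And>b c. lin A D (\<lambda>a. F a b c))
    \<Longrightarrow> trilin A B C D F"
  by (simp add: trilin_def bilin_def)

text \<open>
  Elements of \<open>TT\<close> outside \<open>tspace\<close> have no Sweedler representation; composing with a linear
  projection onto \<open>tspace\<close> makes the induced map linear on all of \<open>TT\<close>.
\<close>

lemma trilin_extend:
  assumes "trilin A B C D F"
  obtains K where "bilin A TT D K" "\<And>a t. t \<in> tspace B C \<Longrightarrow> K a t = sweedler B C t (F a)"
    "\<And>a b c. K a (tens B C b c) = F a b c"
proof -
  have F: "\<And>a. bilin B C D (F a)" "\<And>b c. lin A D (\<lambda>a. F a b c)"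
    using assms by (auto simp: trilin_def)
  from tensor_projection[of B C] obtain pr where pr: "lin TT TT pr" "\<And>t. pr t \<in> tspace B C"
    "\<And>t. t \<in> tspace B C \<Longrightarrow> pr t = t" by metis
  have "bilin A TT D (\<lambda>a t. sweedler B C (pr t) (F a))"
    by (intro bilinI lin_sweedler_tensor pr F lin_sweedler_param)
  then show thesis
    by (rule that) (simp_all add: pr(3) tens_in_tspace bilin_dom[OF F(1)] sweedler_tens[OF F(1)])
qed

lemma sweedler_cong:
  "(\<And>a b. f a b = g a b) \<Longrightarrow> sweedler A B t f = sweedler A B t g"
  by presburger

section \<open>Braided Hopf algebras\<close>

named_theorems lin_intros

lemmas [lin_intros] = bilinI trilinI lin_ident lin_scale_right lin_scale_left lin_times_left
  lin_times_right lin_sub lin_sweedler_param vspace_TT vspace_ground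

locale braided_hopf_pair =
  fixes H :: "('k::field, 'h::ab_group_add) hopf"
    and B :: "('k, 'h, 'b::ab_group_add) bhopf"
  assumes hopf: "hopf_algebra H" and braided: "braided_hopf H B"
begin

abbreviation SH where "SH h \<equiv> sweedler H H (hcomul H h)"
abbreviation SB where "SB b \<equiv> sweedler B B (bcomul B b)"
abbreviation SC where "SC b \<equiv> sweedler H B (coact B b)"

lemma vspace_H [lin_intros, simp]: "vspace H"
  and vspace_B [lin_intros, simp]: "vspace B"
  and bilin_hmul: "bilin H H H (hmul H)"
  and bilin_act: "bilin H B B (act B)"
  and bilin_bmul: "bilin B B B (bmul B)"
  and lin_hcounit: "lin H ground (hcounit H)"
  and lin_bcounit: "lin B ground (bcounit B)"
  and lin_hcomul: "lin H TT (hcomul H)" and hcomul_tspace: "hcomul H h \<in> tspace H H"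
  and lin_bcomul: "lin B TT (bcomul B)" and bcomul_tspace: "bcomul B b \<in> tspace B B"
  and lin_coact: "lin B TT (coact B)" and coact_tspace: "coact B b \<in> tspace H B"
  using hopf braided
  by (auto simp: hopf_algebra_def braided_hopf_def assoc_algebra_def coalgebra_def yd_module_def
    h_module_def h_comodule_def h_module_algebra_def)

lemmas lin_sweedlers [lin_intros] =
  lin_sweedler_tensor[OF lin_compose[OF lin_hcomul] hcomul_tspace]
  lin_sweedler_tensor[OF lin_compose[OF lin_bcomul] bcomul_tspace]
  lin_sweedler_tensor[OF lin_compose[OF lin_coact] coact_tspace]

text \<open>Each operation is stored precomposed with a linear map, so that \<open>intro\<close>
  follows the structure of a term down to its variables.\<close>

lemmas lin_ops [lin_intros] =
  bilin_lin_left[OF bilin_hmul] bilin_lin_right[OF bilin_hmul]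
  bilin_lin_left[OF bilin_act] bilin_lin_right[OF bilin_act]
  bilin_lin_left[OF bilin_bmul] bilin_lin_right[OF bilin_bmul]
  bilin_lin_left[OF bilin_tens] bilin_lin_right[OF bilin_tens]
  lin_compose[OF lin_hcounit] lin_compose[OF lin_bcounit]
  lin_compose[OF lin_hcomul] lin_compose[OF lin_bcomul] lin_compose[OF lin_coact]

lemma act_one: "act B (hone H) b = b"
  and act_hmul: "act B (hmul H g h) b = act B g (act B h b)"
  and bcounit_act: "bcounit B (act B h b) = hcounit H h * bcounit B b"
  and bcounit_bmul: "bcounit B (bmul B a b) = bcounit B a * bcounit B b"
  and bcounit_bone: "bcounit B (bone B) = 1"
  using braided by (auto simp: braided_hopf_def yd_module_def h_module_def)

text \<open>The counit axiom pushed through a linear \<open>F\<close>, which is the shape it takes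
  inside longer Sweedler sums.\<close>

lemma bcounit_left:
  assumes "lin B D F" shows "SB a (\<lambda>x y. scale D (bcounit B x) (F y)) = F a"
proof -
  have "F (SB a (\<lambda>x y. scale B (bcounit B x) y)) = F a"
    using braided by (simp add: braided_hopf_def coalgebra_def)
  then show ?thesis by (simp add: lin_sweedler[OF assms] lin_scale[OF assms])
qed

lemma bcounit_right:
  assumes "lin B D F" shows "SB a (\<lambda>x y. scale D (bcounit B y) (F x)) = F a"
proof -
  have "F (SB a (\<lambda>x y. scale B (bcounit B y) x)) = F a"
    using braided by (simp add: braided_hopf_def coalgebra_def)
  then show ?thesis by (simp add: lin_sweedler[OF assms] lin_scale[OF assms])
qed

lemma hcounit_coact:
  assumes "lin B D F" shows "SC a (\<lambda>g w. scale D (hcounit H g) (F w)) = F a"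
proof -
  have "F (SC a (\<lambda>g w. scale B (hcounit H g) w)) = F a"
    using braided by (simp add: braided_hopf_def yd_module_def h_comodule_def)
  then show ?thesis by (simp add: lin_sweedler[OF assms] lin_scale[OF assms])
qed

text \<open>The counit is colinear for the trivial coaction on the ground field.\<close>

lemma bcounit_coact:
  assumes "lin H D F"
  shows "SC a (\<lambda>g w. scale D (bcounit B w) (F g)) = scale D (bcounit B a) (F (hone H))"
proof -
  have "F (SC a (\<lambda>g w. scale H (bcounit B w) g)) = F (scale H (bcounit B a) (hone H))"
    using braided by (simp add: braided_hopf_def)
  then show ?thesis by (simp add: lin_sweedler[OF assms] lin_scale[OF assms])
qed

text \<open>The axiom equates two tensors over \<open>B\<close> and \<open>TT\<close>. Evaluating
  both with the bilinear extension \<open>K\<close> of \<open>F\<close> frees the rule from the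
  particular tensors; the other coassociativity rules are obtained in the same way.\<close>

lemma coassoc:
  assumes "trilin B B B D F"
  shows "SB a (\<lambda>x z. SB x (\<lambda>u v. F u v z)) = SB a (\<lambda>x z. SB z (\<lambda>u v. F x u v))"
proof -
  obtain K where K: "bilin B TT D K" "\<And>a t. t \<in> tspace B B \<Longrightarrow> K a t = sweedler B B t (F a)"
    "\<And>a b c. K a (tens B B b c) = F a b c"
    using trilin_extend[OF assms] by metis
  have "SB a (\<lambda>x z. SB x (\<lambda>u v. tens B TT u (tens B B v z)))
      = SB a (\<lambda>x z. tens B TT x (bcomul B z))"
    using braided by (simp add: braided_hopf_def coalgebra_def)
  from arg_cong[OF this, of "\<lambda>t. sweedler B TT t K"] show ?thesis
    by (simp add: sweedler_bind[OF K(1)] tspace_sweedler tens_in_tspace vspace_TT sweedler_tens[OF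
      K(1)]
        K(2,3) bcomul_tspace)
qed

lemma coact_coassoc:
  assumes "trilin H H B D F"
  shows "SC a (\<lambda>g w. SH g (\<lambda>g1 g2. F g1 g2 w)) = SC a (\<lambda>g w. SC w (\<lambda>h v. F g h v))"
proof -
  obtain K where K: "bilin H TT D K" "\<And>a t. t \<in> tspace H B \<Longrightarrow> K a t = sweedler H B t (F a)"
    "\<And>a b c. K a (tens H B b c) = F a b c"
    using trilin_extend[OF assms] by metis
  have "SC a (\<lambda>g w. SH g (\<lambda>g1 g2. tens H TT g1 (tens H B g2 w)))
      = SC a (\<lambda>g w. tens H TT g (coact B w))"
    using braided by (simp add: braided_hopf_def yd_module_def h_comodule_def)
  from arg_cong[OF this, of "\<lambda>t. sweedler H TT t K"] show ?thesis
    by (simp add: sweedler_bind[OF K(1)] tspace_sweedler tens_in_tspace vspace_TT sweedler_tens[OF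
      K(1)]
        K(2,3) coact_tspace)
qed

text \<open>The coproduct is colinear for the codiagonal coaction on
  \<open>B \<otimes> B\<close>.\<close>

lemma coact_bcomul:
  assumes "trilin H B B D F"
  shows "SC a (\<lambda>g w. SB w (\<lambda>u v. F g u v))
       = SB a (\<lambda>x y. SC x (\<lambda>g u. SC y (\<lambda>h v. F (hmul H g h) u v)))"
proof -
  obtain K where K: "bilin H TT D K" "\<And>a t. t \<in> tspace B B \<Longrightarrow> K a t = sweedler B B t (F a)"
    "\<And>a b c. K a (tens B B b c) = F a b c"
    using trilin_extend[OF assms] by metis
  have "SC a (\<lambda>g a0. tens H TT g (bcomul B a0)) =
        SB a (\<lambda>a1 a2. SC a1 (\<lambda>g a10. SC a2 (\<lambda>h a20. tens H TT (hmul H g h) (tens B B a10 a20))))"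
    using braided by (simp add: braided_hopf_def)
  from arg_cong[OF this, of "\<lambda>t. sweedler H TT t K"] show ?thesis
    by (simp add: sweedler_bind[OF K(1)] tspace_sweedler tens_in_tspace vspace_TT sweedler_tens[OF
      K(1)]
        K(2,3) bcomul_tspace)
qed

lemma bcomul_act:
  assumes "bilin B B D F"
  shows "SB (act B h a) F = SH h (\<lambda>h1 h2. SB a (\<lambda>x y. F (act B h1 x) (act B h2 y)))"
proof -
  have eq: "bcomul B (act B h a) = SH h (\<lambda>h1 h2. SB a (\<lambda>x y. tens B B (act B h1 x) (act B h2 y)))"
    using braided by (simp add: braided_hopf_def)
  show ?thesis unfolding eq
    by (simp add: sweedler_bind[OF assms] tspace_sweedler tens_in_tspace sweedler_tens[OF assms])
qed

lemma bcomul_bmul: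
  assumes "bilin B B D F"
  shows "SB (bmul B a b) F = bsweedler H B a b (\<lambda>a1 b1 a2 b2. F (bmul B a1 b1) (bmul B a2 b2))"
proof -
  have eq: "bcomul B (bmul B a b)
      = bsweedler H B a b (\<lambda>a1 b1 a2 b2. tens B B (bmul B a1 b1) (bmul B a2 b2))"
    using braided by (simp add: braided_hopf_def)
  show ?thesis unfolding eq unfolding bsweedler_def
    by (simp add: sweedler_bind[OF assms] tspace_sweedler tens_in_tspace sweedler_tens[OF assms])
qed

lemma bcomul_bone:
  assumes "bilin B B D F" shows "SB (bone B) F = F (bone B) (bone B)"
  using braided sweedler_tens[OF assms] by (simp add: braided_hopf_def)

text \<open>Coassociativity of the braided coalgebra \<open>B \<otimes> B\<close>, tested on maps
  linear in each of six arguments. It rests on coassociativity of the coproduct and of the coaction,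
  and on the coproduct being a morphism of Yetter-Drinfeld modules.\<close>

lemma braided_coassoc:
  assumes G: "\<And>b c d e f. lin B D (\<lambda>a. G a b c d e f)"
    "\<And>a c d e f. lin B D (\<lambda>b. G a b c d e f)"
    "\<And>a b d e f. lin B D (\<lambda>c. G a b c d e f)"
    "\<And>a b c e f. lin B D (\<lambda>d. G a b c d e f)"
    "\<And>a b c d f. lin B D (\<lambda>e. G a b c d e f)"
    "\<And>a b c d e. lin B D (\<lambda>f. G a b c d e f)"
  shows "bsweedler H B a b (\<lambda>a1 b1 a2 b2. bsweedler H B a1 b1 (\<lambda>u v w z. G u v w z a2 b2))
       = bsweedler H B a b (\<lambda>a1 b1 a2 b2. bsweedler H B a2 b2 (G a1 b1))"
proof -
  note G' = G[THEN lin_compose]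
  \<comment> \<open>The common normal form: \<open>a\<close> and \<open>b\<close> are each split in
    three, \<open>a2\<close> acts on \<open>b1\<close>, and the coaction of \<open>a3\<close>, taken
    twice, acts on \<open>b1\<close> and \<open>b2\<close>.\<close>
  let ?N = "SB a (\<lambda>a1 a'. SB a' (\<lambda>a2 a3. SB b (\<lambda>b1 b'. SB b' (\<lambda>b2 b3. SC a2 (\<lambda>h a20. SC a3 (\<lambda>g a3'.
       SC a3' (\<lambda>g' a30. G a1 (act B h (act B g b1)) a20 (act B g' b2) a30 b3)))))))"
  have "bsweedler H B a b (\<lambda>a1 b1 a2 b2. bsweedler H B a1 b1 (\<lambda>u v w z. G u v w z a2 b2))
     = SB a (\<lambda>a1 a2. SB b (\<lambda>b1 b2. SC a2 (\<lambda>g a20. SB a1 (\<lambda>a11 a12. SH g (\<lambda>g1 g2.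
        SB b1 (\<lambda>b11 b12. SC a12 (\<lambda>h a120. G a11 (act B h (act B g1 b11)) a120
            (act B g2 b12) a20 b2)))))))"
    \<comment> \<open>Here the coproduct is taken of an element \<open>act B g b1\<close>, so
      \<open>H\<close>-linearity of the coproduct splits \<open>g\<close>.\<close>
    unfolding bsweedler_def by (intro sweedler_cong bcomul_act[where D = D] lin_intros G')
  also have "\<dots> = SB a (\<lambda>a1 a2. SB a1 (\<lambda>a11 a12. SB b (\<lambda>b1 b2. SB b1 (\<lambda>b11 b12. SC a2 (\<lambda>g a20. SH g
      (\<lambda>g1 g2.
        SC a12 (\<lambda>h a120. G a11 (act B h (act B g1 b11)) a120 (act B g2 b12) a20 b2)))))))"
    by (simp only: sweedler_commute[of H B _ B B] sweedler_commute[of H H _ B B]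
        sweedler_commute[of B B "bcomul B b" B B])
  also have "\<dots> = SB a (\<lambda>a1 a'. SB a' (\<lambda>a2 a3. SB b (\<lambda>b1 b2. SB b1 (\<lambda>b11 b12. SC a3 (\<lambda>g a20. SH g
      (\<lambda>g1 g2.
        SC a2 (\<lambda>h a120. G a1 (act B h (act B g1 b11)) a120 (act B g2 b12) a20 b2)))))))"
    by (intro coassoc[where D = D] lin_intros G')
  also have "\<dots> = SB a (\<lambda>a1 a'. SB a' (\<lambda>a2 a3. SB b (\<lambda>b1 b'. SB b' (\<lambda>b2 b3. SC a3 (\<lambda>g a20. SH g
      (\<lambda>g1 g2.
        SC a2 (\<lambda>h a120. G a1 (act B h (act B g1 b1)) a120 (act B g2 b2) a20 b3)))))))"
    by (rule sweedler_cong, rule sweedler_cong) (intro coassoc[where D = D] lin_intros G')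
  also have "\<dots> = SB a (\<lambda>a1 a'. SB a' (\<lambda>a2 a3. SB b (\<lambda>b1 b'. SB b' (\<lambda>b2 b3. SC a3 (\<lambda>g a3'. SC a3'
      (\<lambda>g' a30.
        SC a2 (\<lambda>h a120. G a1 (act B h (act B g b1)) a120 (act B g' b2) a30 b3)))))))"
    \<comment> \<open>The two halves of the split \<open>g\<close> become two successive coactions
      of \<open>a3\<close>.\<close>
    by (intro sweedler_cong coact_coassoc[where D = D] lin_intros G')
  also have "\<dots> = ?N"
    by (intro sweedler_cong, subst sweedler_commute, intro sweedler_cong, subst sweedler_commute)
      (rule refl)
  finally have L: "bsweedler H B a b (\<lambda>a1 b1 a2 b2. bsweedler H B a1 b1
      (\<lambda>u v w z. G u v w z a2 b2)) = ?N" .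
  have "bsweedler H B a b (\<lambda>a1 b1 a2 b2. bsweedler H B a2 b2 (G a1 b1))
     = SB a (\<lambda>a1 a'. SB b (\<lambda>b1 b'. SB a' (\<lambda>a2 a3. SC a2 (\<lambda>h a20. SC a3 (\<lambda>g a3'. SB b' (\<lambda>b2 b3.
         SC a3' (\<lambda>g' a30. G a1 (act B (hmul H h g) b1) a20 (act B g' b2) a30 b3)))))))"
    \<comment> \<open>On the right, the coaction of \<open>a'\<close> is taken before its coproduct;
      colinearity of the coproduct reverses this order and produces
      \<open>hmul H h g\<close>.\<close>
    unfolding bsweedler_def by (intro sweedler_cong coact_bcomul[where D = D] lin_intros G')
  also have "\<dots> = ?N"
    by (simp only: sweedler_commute[of H B _ B B] sweedler_commute[of B B
      "bcomul B b" B B] act_hmul)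
  finally show ?thesis using L by simp
qed

end

section \<open>Convolution with values in a comodule algebra\<close>

lemma lin_bsweedler:
  "lin C D \<phi> \<Longrightarrow> \<phi> (bsweedler H B a b F) = bsweedler H B a b (\<lambda>a1 b1 a2 b2. \<phi> (F a1 b1 a2 b2))"
  by (simp add: bsweedler_def lin_sweedler)

locale braided_comodule_algebra = braided_hopf_pair H B
  for H :: "('k::field, 'h::ab_group_add) hopf" and B :: "('k, 'h, 'b::ab_group_add) bhopf" +
  fixes E :: "('k, 'h, 'e::ab_group_add, 'b) comod_alg"
  assumes comod_alg: "comodule_algebra H B E"
begin

abbreviation SE where "SE e \<equiv> sweedler E B (rho E e)"

lemma vspace_E [lin_intros, simp]: "vspace E"
  and bilin_actE: "bilin H E E (act E)"
  and bilin_cmul: "bilin E E E (cmul E)"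
  and lin_rho: "lin E TT (rho E)" and rho_tspace: "rho E e \<in> tspace E B"
  and cmul_assoc: "cmul E (cmul E c d) e = cmul E c (cmul E d e)"
  and cmul_cone: "cmul E e (cone E) = e" "cmul E (cone E) e = e"
  and act_cmul: "act E h (cmul E d e) = SH h (\<lambda>h1 h2. cmul E (act E h1 d) (act E h2 e))"
  and rho_cone: "rho E (cone E) = tens E B (cone E) (bone B)"
  using comod_alg
  by (auto simp: comodule_algebra_def assoc_algebra_def h_module_def h_module_algebra_def)

lemmas lin_opsE [lin_intros] =
  lin_sweedler_tensor[OF lin_compose[OF lin_rho] rho_tspace]
  bilin_lin_left[OF bilin_actE] bilin_lin_right[OF bilin_actE]
  bilin_lin_left[OF bilin_cmul] bilin_lin_right[OF bilin_cmul]
  lin_compose[OF lin_rho]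

lemma cmul_scale: "cmul E (scale E c d) e = scale E c (cmul E d e)"
    "cmul E d (scale E c e) = scale E c (cmul E d e)"
  using bilin_cmul by (auto simp: bilin_def lin_iff)

lemma cmul_sweedler: "cmul E (sweedler X Y t F) e = sweedler X Y t (\<lambda>x y. cmul E (F x y) e)"
    "cmul E e (sweedler X Y t F) = sweedler X Y t (\<lambda>x y. cmul E e (F x y))"
  using lin_sweedler[of E E "\<lambda>d. cmul E d e"] lin_sweedler[of E E "cmul E e"] bilin_cmul
  by (auto simp: bilin_def)

lemma rho_coassoc:
  assumes "trilin E B B D F"
  shows "SE e (\<lambda>e' c. SE e' (\<lambda>e0 b. F e0 b c)) = SE e (\<lambda>e0 b. SB b (\<lambda>u v. F e0 u v))"
proof -
  obtain K where K: "bilin E TT D K" "\<And>a t. t \<in> tspace B B \<Longrightarrow> K a t = sweedler B B t (F a)"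
    "\<And>a b c. K a (tens B B b c) = F a b c"
    using trilin_extend[OF assms] by metis
  have "SE e (\<lambda>e' c. SE e' (\<lambda>e0 b. tens E TT e0 (tens B B b c)))
      = SE e (\<lambda>e0 b. tens E TT e0 (bcomul B b))"
    using comod_alg by (simp add: comodule_algebra_def)
  from arg_cong[OF this, of "\<lambda>t. sweedler E TT t K"] show ?thesis
    by (simp add: sweedler_bind[OF K(1)] tspace_sweedler tens_in_tspace vspace_TT sweedler_tens[OF
      K(1)]
        K(2,3) bcomul_tspace)
qed

lemma rho_counit:
  assumes "lin E D F" shows "SE e (\<lambda>e0 b. scale D (bcounit B b) (F e0)) = F e"
proof -
  have "F (SE e (\<lambda>e0 b. scale E (bcounit B b) e0)) = F e"
    using comod_alg by (simp add: comodule_algebra_def)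
  then show ?thesis by (simp add: lin_sweedler[OF assms] lin_scale[OF assms])
qed

lemma rho_cmul:
  assumes "bilin E B D F"
  shows "SE (cmul E d e) F = SE d (\<lambda>d0 d1. SE e (\<lambda>e0 e1. SC d1 (\<lambda>g d10.
            F (cmul E d0 (act E g e0)) (bmul B d10 e1))))"
proof -
  have eq: "rho E (cmul E d e) = SE d (\<lambda>d0 d1. SE e (\<lambda>e0 e1. SC d1 (\<lambda>g d10.
            tens E B (cmul E d0 (act E g e0)) (bmul B d10 e1))))"
    using comod_alg by (simp add: comodule_algebra_def)
  show ?thesis unfolding eq
    by (simp add: sweedler_bind[OF assms] tspace_sweedler tens_in_tspace sweedler_tens[OF assms])
qed

text \<open>Colinearity is used in this form: a coaction on an image of \<open>\<gamma>\<close>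
  becomes a coproduct in \<open>B\<close>.\<close>

lemma SE_colinear:
  assumes "\<And>b. rho E (\<gamma> b) = tmap B B E B \<gamma> id (bcomul B b)" and F: "bilin E B D F"
  shows "SE (\<gamma> b) F = SB b (\<lambda>x y. F (\<gamma> x) y)"
  by (simp add: assms(1) tmap_def sweedler_bind[OF F] tens_in_tspace sweedler_tens[OF F])

text \<open>Convolution of linear maps \<open>B \<otimes> B \<rightarrow> E\<close>, with such maps
  curried to bilinear ones.\<close>

definition conv :: "('b \<Rightarrow> 'b \<Rightarrow> 'e) \<Rightarrow> ('b \<Rightarrow> 'b \<Rightarrow> 'e) \<Rightarrow> 'b \<Rightarrow> 'b \<Rightarrow> 'e" where
  "conv f g a b = bsweedler H B a b (\<lambda>a1 b1 a2 b2. cmul E (f a1 b1) (g a2 b2))"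

definition conv_unit :: "'b \<Rightarrow> 'b \<Rightarrow> 'e" where
  "conv_unit a b = scale E (bcounit B a * bcounit B b) (cone E)"

lemma bilin_conv:
  assumes "bilin B B E f" "bilin B B E g" shows "bilin B B E (conv f g)"
  unfolding conv_def[abs_def] bsweedler_def
  by (intro lin_intros assms[THEN bilin_lin_left] assms[THEN bilin_lin_right])

lemma conv_assoc:
  assumes "bilin B B E f" "bilin B B E g" "bilin B B E h"
  shows "conv (conv f g) h = conv f (conv g h)"
proof (intro ext)
  fix a b
  have "conv (conv f g) h a b = bsweedler H B a b (\<lambda>a1 b1 a2 b2. bsweedler H B a1 b1 (\<lambda>u v w z.
      cmul E (f u v) (cmul E (g w z) (h a2 b2))))"
    unfolding conv_def by (simp only: cmul_sweedler bsweedler_def cmul_assoc)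
  also have "\<dots> = bsweedler H B a b (\<lambda>a1 b1 a2 b2. bsweedler H B a2 b2 (\<lambda>u v w z.
      cmul E (f a1 b1) (cmul E (g u v) (h w z))))"
    by (rule braided_coassoc[where D = E])
      (intro lin_intros assms[THEN bilin_lin_left] assms[THEN bilin_lin_right])+
  also have "\<dots> = conv f (conv g h) a b"
    unfolding conv_def by (simp only: cmul_sweedler bsweedler_def)
  finally show "conv (conv f g) h a b = conv f (conv g h) a b" .
qed

text \<open>The element acting on the \<open>b\<close> leg comes from a leg of \<open>a\<close> that
  meets the counit, so colinearity of the counit replaces it by the unit of
  \<open>H\<close>.\<close>

lemma conv_unit_right:
  assumes "bilin B B E f" shows "conv f conv_unit = f"
proof (intro ext)
  fix a b
  note f = assms[THEN bilin_lin_left] assms[THEN bilin_lin_right]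
  have "conv f conv_unit a b = SB a (\<lambda>a1 a2. SB b (\<lambda>b1 b2. SC a2 (\<lambda>g w.
      scale E (bcounit B w) (scale E (bcounit B b2) (f a1 (act B g b1))))))"
    unfolding conv_def conv_unit_def bsweedler_def by (simp add: cmul_scale cmul_cone scale_scale)
  also have "\<dots> = SB a (\<lambda>a1 a2. SB b (\<lambda>b1 b2. scale E (bcounit B a2) (scale E (bcounit B b2) (f a1
      (act B (hone H) b1)))))"
    by (intro sweedler_cong bcounit_coact lin_intros f)
  also have "\<dots> = SB a (\<lambda>a1 a2. SB b (\<lambda>b1 b2. scale E (bcounit B b2) (scale E (bcounit B a2)
      (f a1 b1))))"
    by (simp add: act_one scale_scale mult.commute)
  also have "\<dots> = SB a (\<lambda>a1 a2. scale E (bcounit B a2) (f a1 b))"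
    by (intro sweedler_cong bcounit_right lin_intros f)
  also have "\<dots> = f a b"
    by (intro bcounit_right lin_intros f)
  finally show "conv f conv_unit a b = f a b" .
qed

text \<open>Here the acted element itself meets the counit, so \<open>H\<close>-linearity of the
  counit is what removes the braiding.\<close>

lemma conv_unit_left:
  assumes "bilin B B E f" shows "conv conv_unit f = f"
proof (intro ext)
  fix a b
  note f = assms[THEN bilin_lin_left] assms[THEN bilin_lin_right]
  have "conv conv_unit f a b = SB a (\<lambda>a1 a2. SB b (\<lambda>b1 b2. SC a2 (\<lambda>g w.
      scale E (hcounit H g) (scale E (bcounit B b1) (scale E (bcounit B a1) (f w b2))))))"
    unfolding conv_def conv_unit_def bsweedler_def
    by (simp add: cmul_scale cmul_cone scale_scale bcounit_act mult_ac)
  also have "\<dots> = SB a (\<lambda>a1 a2. SB b (\<lambda>b1 b2. scale E (bcounit B b1) (scale E (bcounit B a1)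
      (f a2 b2))))"
    by (intro sweedler_cong hcounit_coact lin_intros f)
  also have "\<dots> = SB a (\<lambda>a1 a2. scale E (bcounit B a1) (f a2 b))"
    by (intro sweedler_cong bcounit_left lin_intros f)
  also have "\<dots> = f a b"
    by (intro bcounit_left lin_intros f)
  finally show "conv conv_unit f a b = f a b" .
qed

text \<open>Forms are embedded along the unit of \<open>E\<close>, so that they can be convolved
  with \<open>E\<close>-valued maps.\<close>

definition scalar_form :: "('b \<Rightarrow> 'b \<Rightarrow> 'k) \<Rightarrow> 'b \<Rightarrow> 'b \<Rightarrow> 'e" where
  "scalar_form \<sigma> a b = scale E (\<sigma> a b) (cone E)"

end

section \<open>The cocycle of a normalized section with a chosen convolution inverse\<close>

locale cleaving = braided_comodule_algebra H B E
  for H :: "('k::field, 'h::ab_group_add) hopf" and B :: "('k, 'h, 'b::ab_group_add) bhopf"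
    and E :: "('k, 'h, 'e::ab_group_add, 'b) comod_alg" +
  fixes \<omega> \<omega>' :: "'b \<Rightarrow> 'e" and \<epsilon>0 :: "'e \<Rightarrow> 'k"
  assumes h_linear_\<omega>: "h_linear B E \<omega>" and bij_\<omega>: "bij \<omega>" and \<omega>_bone: "\<omega> (bone B) = cone E"
    and \<omega>_colinear: "\<And>b. rho E (\<omega> b) = tmap B B E B \<omega> id (bcomul B b)"
    and lin_\<omega>': "lin B E \<omega>'"
    and \<omega>_\<omega>': "\<And>b. sweedler B B (bcomul B b) (\<lambda>b1 b2. cmul E (\<omega> b1) (\<omega>' b2))
               = scale E (bcounit B b) (cone E)"
    and \<omega>'_\<omega>: "\<And>b. sweedler B B (bcomul B b) (\<lambda>b1 b2. cmul E (\<omega>' b1) (\<omega> b2))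
               = scale E (bcounit B b) (cone E)"
    and lin_\<epsilon>0: "lin E ground \<epsilon>0" and \<epsilon>0_\<omega>: "\<And>b. \<epsilon>0 (\<omega> b) = bcounit B b"
begin

lemma lin_\<omega>: "lin B E \<omega>" and \<omega>_act: "\<omega> (act B h b) = act E h (\<omega> b)"
  using h_linear_\<omega> by (auto simp: h_linear_def)

lemmas lin_ops\<omega> [lin_intros] = lin_compose[OF lin_\<omega>] lin_compose[OF lin_\<omega>'] lin_compose[OF lin_\<epsilon>0]

definition \<sigma> :: "'b \<Rightarrow> 'b \<Rightarrow> 'k" where
  "\<sigma> a b = \<epsilon>0 (cmul E (\<omega> a) (\<omega> b))"

definition twisted_mul :: "'b \<Rightarrow> 'b \<Rightarrow> 'b" where
  "twisted_mul a b = bsweedler H B a b (\<lambda>a1 b1 a2 b2. scale B (\<sigma> a1 b1) (bmul B a2 b2))"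

lemma bilin_\<sigma>: "bilin B B ground \<sigma>"
  unfolding \<sigma>_def[abs_def] by (intro lin_intros)

lemmas lin_\<sigma> [lin_intros] = bilin_\<sigma>[THEN bilin_lin_left] bilin_\<sigma>[THEN bilin_lin_right]

lemmas SE_\<omega> = SE_colinear[OF \<omega>_colinear]

text \<open>Colinearity of \<open>\<omega>\<close> and
  \<open>\<epsilon>0 \<omega> = \<epsilon>\<close> make
  \<open>(\<epsilon>0 \<otimes> id) \<rho>\<close> a left inverse of
  \<open>\<omega>\<close>.\<close>

lemma \<omega>_inverse: "SE (\<omega> b) (\<lambda>e c. scale B (\<epsilon>0 e) c) = b"
proof -
  have "SE (\<omega> b) (\<lambda>e c. scale B (\<epsilon>0 e) c) = SB b (\<lambda>x y. scale B (\<epsilon>0 (\<omega> x)) y)"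
    by (rule SE_\<omega>[where D = B]) (intro lin_intros)
  also have "\<dots> = b" unfolding \<epsilon>0_\<omega> by (rule bcounit_left) (intro lin_intros)
  finally show ?thesis .
qed

text \<open>The product lies in the range of \<open>\<omega>\<close>; its preimage is read off with
  \<open>\<omega>_inverse\<close>, after multiplicativity of the coaction has exposed
  \<open>\<sigma>\<close>.\<close>

lemma \<omega>_twisted_mul: "\<omega> (twisted_mul a b) = cmul E (\<omega> a) (\<omega> b)"
proof -
  obtain z where z: "cmul E (\<omega> a) (\<omega> b) = \<omega> z" using bij_\<omega> by (metis bij_pointE)
  have "z = SE (cmul E (\<omega> a) (\<omega> b)) (\<lambda>e c. scale B (\<epsilon>0 e) c)"
    by (simp add: z \<omega>_inverse)
  also have "\<dots> = SE (\<omega> a) (\<lambda>d0 d1. SE (\<omega> b) (\<lambda>e0 e1. SC d1 (\<lambda>g d10.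
            scale B (\<epsilon>0 (cmul E d0 (act E g e0))) (bmul B d10 e1))))"
    by (rule rho_cmul[where D = B]) (intro lin_intros)
  also have "\<dots> = SB a (\<lambda>a1 a2. SE (\<omega> b) (\<lambda>e0 e1. SC a2 (\<lambda>g d10.
            scale B (\<epsilon>0 (cmul E (\<omega> a1) (act E g e0))) (bmul B d10 e1))))"
    by (rule SE_\<omega>[where D = B]) (intro lin_intros)
  also have "\<dots> = SB a (\<lambda>a1 a2. SB b (\<lambda>b1 b2. SC a2 (\<lambda>g d10.
            scale B (\<epsilon>0 (cmul E (\<omega> a1) (act E g (\<omega> b1)))) (bmul B d10 b2))))"
    by (intro sweedler_cong SE_\<omega>[where D = B] lin_intros)
  also have "\<dots> = twisted_mul a b"
    by (simp add: twisted_mul_def \<sigma>_def bsweedler_def \<omega>_act)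
  finally show ?thesis using z by simp
qed

text \<open>These rewrite the two sides of the cocycle identity as values of \<open>\<sigma>\<close>
  on twisted products.\<close>

lemma \<sigma>_twisted_mul: "\<sigma> (twisted_mul x y) z
    = bsweedler H B x y (\<lambda>x1 y1 x2 y2. \<sigma> x1 y1 * \<sigma> (bmul B x2 y2) z)"
    "\<sigma> x (twisted_mul y z) = bsweedler H B y z (\<lambda>y1 z1 y2 z2. \<sigma> y1 z1 * \<sigma> x (bmul B y2 z2))"
proof -
  have 1: "lin B ground (\<lambda>x. \<sigma> x z)" and 2: "lin B ground (\<sigma> x)"
    using bilin_\<sigma> by (auto simp: bilin_def)
  show "\<sigma> (twisted_mul x y) z = bsweedler H B x y (\<lambda>x1 y1 x2 y2. \<sigma> x1 y1 * \<sigma> (bmul B x2 y2) z)"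
    unfolding twisted_mul_def lin_bsweedler[OF 1] lin_scale[OF 1] by (simp add: ground_def)
  show "\<sigma> x (twisted_mul y z) = bsweedler H B y z (\<lambda>y1 z1 y2 z2. \<sigma> y1 z1 * \<sigma> x (bmul B y2 z2))"
    unfolding twisted_mul_def lin_bsweedler[OF 2] lin_scale[OF 2] by (simp add: ground_def)
qed

text \<open>Every element of \<open>E\<close> is some \<open>\<omega> b\<close>, where the counit of
  \<open>B\<close> is known to be \<open>H\<close>-linear.\<close>

lemma \<epsilon>0_act: "\<epsilon>0 (act E h e) = hcounit H h * \<epsilon>0 e"
proof -
  obtain b where "e = \<omega> b" using bij_\<omega> by (metis bij_pointE)
  then show ?thesis by (simp flip: \<omega>_act add: \<epsilon>0_\<omega> bcounit_act)
qed

lemma \<sigma>_h_linear: "SH h (\<lambda>h1 h2. \<sigma> (act B h1 a) (act B h2 b)) = hcounit H h * \<sigma> a b"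
  unfolding \<sigma>_def \<epsilon>0_act[symmetric] act_cmul lin_sweedler[OF lin_\<epsilon>0] \<omega>_act ..

definition section_mul where "section_mul a b = cmul E (\<omega> a) (\<omega> b)"
text \<open>The inverse of a product has its factors in reverse order; the braiding \<open>c\<close>
  is what exchanges them.\<close>

definition section_mul_inv where "section_mul_inv a b
    = SC a (\<lambda>g a0. cmul E (\<omega>' (act B g b)) (\<omega>' a0))"
definition mul_section where "mul_section a b = \<omega> (bmul B a b)"
definition mul_section_inv where "mul_section_inv a b = \<omega>' (bmul B a b)"

lemma bilin_section_muls: "bilin B B E section_mul" "bilin B B E section_mul_inv"
    "bilin B B E mul_section" "bilin B B E mul_section_inv" "bilin B B E (scalar_form \<sigma>)"
  unfolding section_mul_def[abs_def] section_mul_inv_def[abs_def] mul_section_def[abs_def]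
      mul_section_inv_def[abs_def] scalar_form_def[abs_def]
  by (intro lin_intros)+

text \<open>Multiplicativity of the coproduct reduces this to the convolution of
  \<open>\<omega>\<close> with \<open>\<omega>'\<close> at \<open>bmul B a b\<close>.\<close>

lemma conv_mul_section: "conv mul_section mul_section_inv = conv_unit"
proof (intro ext)
  fix a b
  have "conv mul_section mul_section_inv a b = SB (bmul B a b) (\<lambda>x y. cmul E (\<omega> x) (\<omega>' y))"
    unfolding conv_def mul_section_def mul_section_inv_def
        by (rule bcomul_bmul[symmetric, where D = E]) (intro lin_intros)
  then show "conv mul_section mul_section_inv a b = conv_unit a b"
      by (simp add: \<omega>_\<omega>' bcounit_bmul conv_unit_def)
qed

lemma conv_scalar_form: "conv (scalar_form \<sigma>) mul_section = section_mul"
proof (intro ext)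
  fix a b
  have "section_mul a b = \<omega> (twisted_mul a b)" by (simp add: section_mul_def \<omega>_twisted_mul)
  then show "conv (scalar_form \<sigma>) mul_section a b = section_mul a b"
    by (simp add: twisted_mul_def lin_bsweedler[OF lin_\<omega>] lin_scale[OF lin_\<omega>] conv_def
      scalar_form_def
        cmul_scale cmul_cone mul_section_def)
qed

text \<open>The factors coming from \<open>b\<close> stand in the middle and cancel first, then
  those coming from \<open>a\<close>.\<close>

lemma conv_section_mul: "conv section_mul section_mul_inv = conv_unit"
proof (intro ext)
  fix a b
  have "conv section_mul section_mul_inv a b = SB a (\<lambda>a1 a2. SB b (\<lambda>b1 b2. SC a2 (\<lambda>g w. SC w (\<lambda>h v.
      cmul E (cmul E (\<omega> a1) (\<omega> (act B g b1))) (cmul E (\<omega>' (act B h b2)) (\<omega>' v))))))"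
    unfolding conv_def bsweedler_def section_mul_def section_mul_inv_def
        by (simp only: cmul_sweedler)
  also have "\<dots> = SB a (\<lambda>a1 a2. SB b (\<lambda>b1 b2. SC a2 (\<lambda>g w. SH g (\<lambda>g1 g2.
      cmul E (cmul E (\<omega> a1) (\<omega> (act B g1 b1))) (cmul E (\<omega>' (act B g2 b2)) (\<omega>' w))))))"
    \<comment> \<open>Both actions now stem from one \<open>g\<close>, so that they assemble into
      the coproduct of \<open>act B g b\<close>.\<close>
    by (intro sweedler_cong coact_coassoc[where D = E, symmetric] lin_intros)
  also have "\<dots> = SB a (\<lambda>a1 a2. SC a2 (\<lambda>g w. cmul E (\<omega> a1) (cmul E (SH g (\<lambda>g1 g2. SB b (\<lambda>b1 b2.
      cmul E (\<omega> (act B g1 b1)) (\<omega>' (act B g2 b2))))) (\<omega>' w))))"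
    by (simp only: cmul_sweedler sweedler_commute[of B B "bcomul B b"] cmul_assoc)
  also have "\<dots> = SB a (\<lambda>a1 a2. SC a2 (\<lambda>g w. cmul E (\<omega> a1) (cmul E
      (SB (act B g b) (\<lambda>x y. cmul E (\<omega> x) (\<omega>' y))) (\<omega>' w))))"
    by (intro sweedler_cong arg_cong2[where f = "cmul E"] refl bcomul_act[where D
      = E, symmetric] lin_intros)
  also have "\<dots> = SB a (\<lambda>a1 a2. SC a2 (\<lambda>g w. scale E (hcounit H g) (scale E (bcounit B b) (cmul E
      (\<omega> a1) (\<omega>' w)))))"
    by (simp only: \<omega>_\<omega>' cmul_scale cmul_cone bcounit_act scale_scale[OF vspace_E])
  also have "\<dots> = SB a (\<lambda>a1 a2. scale E (bcounit B b) (cmul E (\<omega> a1) (\<omega>' a2)))"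
    by (intro sweedler_cong hcounit_coact lin_intros)
  also have "\<dots> = scale E (bcounit B b) (SB a (\<lambda>a1 a2. cmul E (\<omega> a1) (\<omega>' a2)))"
    by (rule lin_sweedler[where C = E and D = E, symmetric]) (intro lin_intros)
  also have "\<dots> = conv_unit a b"
    by (simp add: \<omega>_\<omega>' conv_unit_def scale_scale mult.commute)
  finally show "conv section_mul section_mul_inv a b = conv_unit a b" .
qed

text \<open>In this order the factors coming from \<open>a\<close> are the inner ones and cancel
  first.\<close>

lemma conv_section_mul_inv: "conv section_mul_inv section_mul = conv_unit"
proof (intro ext)
  fix a b
  have "conv section_mul_inv section_mul a b = SB a (\<lambda>a1 a2. SB b (\<lambda>b1 b2. SC a2 (\<lambda>g v. SC a1 (\<lambda>h u.
      cmul E (cmul E (\<omega>' (act B h (act B g b1))) (\<omega>' u)) (cmul E (\<omega> v) (\<omega> b2))))))"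
    unfolding conv_def bsweedler_def section_mul_def section_mul_inv_def
        by (simp only: cmul_sweedler)
  also have "\<dots> = SB a (\<lambda>a1 a2. SB b (\<lambda>b1 b2. SC a1 (\<lambda>h u. SC a2 (\<lambda>g v.
      cmul E (cmul E (\<omega>' (act B (hmul H h g) b1)) (\<omega>' u)) (cmul E (\<omega> v) (\<omega> b2))))))"
    unfolding act_hmul by (rule sweedler_cong, rule sweedler_cong, rule sweedler_commute)
  also have "\<dots> = SB b (\<lambda>b1 b2. SB a (\<lambda>a1 a2. SC a1 (\<lambda>h u. SC a2 (\<lambda>g v.
      cmul E (cmul E (\<omega>' (act B (hmul H h g) b1)) (\<omega>' u)) (cmul E (\<omega> v) (\<omega> b2))))))"
    by (rule sweedler_commute)
  also have "\<dots> = SB b (\<lambda>b1 b2. SC a (\<lambda>k w. SB w (\<lambda>u v.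
      cmul E (cmul E (\<omega>' (act B k b1)) (\<omega>' u)) (cmul E (\<omega> v) (\<omega> b2)))))"
    \<comment> \<open>The two coactions on the legs of \<open>a\<close> merge into one coaction of
      \<open>a\<close>, leaving a coproduct of \<open>w\<close> on which \<open>\<omega>'\<close>
      and \<open>\<omega>\<close> cancel.\<close>
    by (intro sweedler_cong coact_bcomul[where D = E, symmetric] lin_intros)
  also have "\<dots> = SB b (\<lambda>b1 b2. SC a (\<lambda>k w. cmul E (\<omega>' (act B k b1)) (cmul E (SB w (\<lambda>u v.
      cmul E (\<omega>' u) (\<omega> v))) (\<omega> b2))))"
    by (simp only: cmul_sweedler cmul_assoc)
  also have "\<dots> = SB b (\<lambda>b1 b2. SC a (\<lambda>k w. scale E (bcounit B w) (cmul E (\<omega>' (act B k b1))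
      (\<omega> b2))))"
    by (simp only: \<omega>'_\<omega> cmul_scale cmul_cone)
  also have "\<dots> = SB b (\<lambda>b1 b2. scale E (bcounit B a) (cmul E (\<omega>' (act B (hone H) b1)) (\<omega> b2)))"
    by (intro sweedler_cong bcounit_coact lin_intros)
  also have "\<dots> = scale E (bcounit B a) (SB b (\<lambda>b1 b2. cmul E (\<omega>' b1) (\<omega> b2)))"
    unfolding act_one by (rule lin_sweedler[where C = E and D = E, symmetric]) (intro lin_intros)
  also have "\<dots> = conv_unit a b"
    by (simp add: \<omega>'_\<omega> conv_unit_def scale_scale mult.commute)
  finally show "conv section_mul_inv section_mul a b = conv_unit a b" .
qed

lemma \<epsilon>0_cone: "\<epsilon>0 (cone E) = 1"
  using \<epsilon>0_\<omega>[of "bone B"] by (simp add: \<omega>_bone bcounit_bone)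

lemma \<epsilon>0_scale: "\<epsilon>0 (scale E c e) = c * \<epsilon>0 e"
  using lin_scale[OF lin_\<epsilon>0] by (simp add: ground_def)

text \<open>In the convolution algebra, \<open>scalar_form \<sigma>\<close> is
  \<open>section_mul\<close> times \<open>mul_section_inv\<close>, and its inverse is
  \<open>mul_section\<close> times \<open>section_mul_inv\<close>. Convolving with a scalar form
  commutes with \<open>\<epsilon>0\<close>, so \<open>\<epsilon>0\<close> of that inverse is an
  inverse over the ground field.\<close>

lemma \<sigma>_invertible:
  obtains \<sigma>' where "bilin B B ground \<sigma>'"
    "\<And>a b. bsweedler H B a b (\<lambda>a1 b1 a2 b2. \<sigma> a1 b1 * \<sigma>' a2 b2) = bcounit B a * bcounit B b"
    "\<And>a b. bsweedler H B a b (\<lambda>a1 b1 a2 b2. \<sigma>' a1 b1 * \<sigma> a2 b2) = bcounit B a * bcounit B b"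
proof
  let ?s = "scalar_form \<sigma>" and ?w = "conv mul_section section_mul_inv"
  note bc = bilin_conv bilin_section_muls
  have "?s = conv ?s (conv mul_section mul_section_inv)"
      by (simp add: conv_mul_section conv_unit_right bilin_section_muls)
  also have "\<dots> = conv section_mul mul_section_inv"
      by (simp add: conv_assoc[symmetric] bilin_section_muls conv_scalar_form)
  finally have s: "?s = conv section_mul mul_section_inv" .
  have 1: "conv ?s ?w = conv_unit"
    by (simp add: conv_assoc[symmetric] bc conv_scalar_form conv_section_mul)
  have "conv ?w ?s = conv mul_section (conv (conv section_mul_inv section_mul) mul_section_inv)"
    unfolding s by (simp add: conv_assoc bc)
  then have 2: "conv ?w ?s = conv_unit"
    by (simp add: conv_section_mul_inv conv_unit_left bilin_section_muls conv_mul_section)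
  show "bilin B B ground (\<lambda>a b. \<epsilon>0 (?w a b))"
    by (rule bilin_functional[OF _ lin_\<epsilon>0]) (intro bc)
  fix a b
  have "\<epsilon>0 (conv ?s ?w a b) = bsweedler H B a b (\<lambda>a1 b1 a2 b2. \<sigma> a1 b1 * \<epsilon>0 (?w a2 b2))"
    unfolding conv_def[of ?s]
        by (simp add: lin_bsweedler[OF lin_\<epsilon>0] scalar_form_def cmul_scale cmul_cone \<epsilon>0_scale)
  then show "bsweedler H B a b (\<lambda>a1 b1 a2 b2. \<sigma> a1 b1 * \<epsilon>0 (?w a2 b2)) = bcounit B a * bcounit B b"
    by (simp add: 1 conv_unit_def \<epsilon>0_scale \<epsilon>0_cone)
  have "\<epsilon>0 (conv ?w ?s a b) = bsweedler H B a b (\<lambda>a1 b1 a2 b2. \<epsilon>0 (?w a1 b1) * \<sigma> a2 b2)"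
    unfolding conv_def[of ?w]
        by (simp add: lin_bsweedler[OF lin_\<epsilon>0] scalar_form_def cmul_scale cmul_cone \<epsilon>0_scale
          mult.commute)
  then show "bsweedler H B a b (\<lambda>a1 b1 a2 b2. \<epsilon>0 (?w a1 b1) * \<sigma> a2 b2) = bcounit B a * bcounit B b"
    by (simp add: 2 conv_unit_def \<epsilon>0_scale \<epsilon>0_cone)
qed

lemma \<sigma>_in_Z2: "\<sigma> \<in> Z2 H B"
proof -
  have "\<sigma> (twisted_mul x y) z = \<sigma> x (twisted_mul y z)" for x y z
    by (simp add: \<sigma>_def \<omega>_twisted_mul cmul_assoc)
  moreover have "\<sigma> x (bone B) = bcounit B x" "\<sigma> (bone B) x = bcounit B x" for x
    by (simp_all add: \<sigma>_def \<omega>_bone cmul_cone \<epsilon>0_\<omega>)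
  ultimately show ?thesis
    unfolding Z2_def \<sigma>_twisted_mul using bilin_\<sigma> \<sigma>_h_linear \<sigma>_invertible by (auto; metis)
qed

text \<open>The isomorphism is the inverse of \<open>\<omega>\<close>.\<close>

lemma iso_cocycle_twist: "comod_alg_iso B E (cocycle_twist H B \<sigma>)"
proof -
  define F where "F = cocycle_twist H B \<sigma>"
  have F: "scale F = scale B" "act F = act B" "cmul F = twisted_mul" "cone F = bone B" "rho F
      = bcomul B"
    by (simp_all add: F_def cocycle_twist_def twisted_mul_def[abs_def])
  define f where "f = inv \<omega>"
  have f: "f (\<omega> b) = b" "\<omega> (f e) = e" for b e
    using bij_\<omega> by (simp_all add: f_def bij_is_inj bij_is_surj surj_f_inv_f)
  have lf: "lin E B f"
    using lin_\<omega> by (auto simp: lin_iff) (metis f)+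
  \<comment> \<open>The twist keeps the scalar multiplication of \<open>B\<close>, so linearity
    means the same for both records.\<close>
  have FB: "lin X F g \<longleftrightarrow> lin X B g" "lin F X h \<longleftrightarrow> lin B X h" for X ::
      "('k, 'x::ab_group_add, 'y) vect_scheme" and g h
    by (simp_all add: lin_def F)
  have "h_linear E F f"
    unfolding h_linear_def F FB using lf by (metis f \<omega>_act)
  moreover have "bij f" using bij_\<omega> by (simp add: f_def bij_imp_bij_inv)
  moreover have "alg_hom E (cmul E) (cone E) F (cmul F) (cone F) f"
    unfolding alg_hom_def F FB using lf by (metis f \<omega>_twisted_mul \<omega>_bone)
  moreover have "rho F (f e) = tmap E B F B f id (rho E e)" for e
  proof -
    have tF: "tens F B = tens B B"
      by (intro ext) (simp add: tens_def bilin_def FB)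
    obtain b where e: "e = \<omega> b" using f by metis
    have "tmap E B F B f id (rho E e) = SB b (\<lambda>x y. tens B B (f (\<omega> x)) y)"
      unfolding tmap_def tF e id_apply
      by (rule SE_\<omega>[where D = TT]) (intro lin_intros lin_compose[OF lf])
    also have "\<dots> = bcomul B b" by (simp add: f sweedler_same bcomul_tspace)
    finally show ?thesis by (simp add: F e f)
  qed
  ultimately show ?thesis unfolding comod_alg_iso_def F_def by blast
qed

end

section \<open>Colinear maps\<close>

context braided_comodule_algebra
begin

text \<open>Writing \<open>\<phi> b = \<psi> c\<close>, the map
  \<open>(\<kappa> \<otimes> \<psi>) \<rho>\<close> fixes \<open>\<psi> c\<close>; expanding the
  coaction through \<open>\<phi>\<close> instead shows that \<open>\<phi>\<close> is the form
  \<open>\<kappa> \<phi>\<close> convolved with \<open>\<psi>\<close>.\<close>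

lemma colinear_iso_change:
  assumes \<psi>: "lin B E \<psi>" "surj \<psi>" "\<And>b. rho E (\<psi> b) = tmap B B E B \<psi> id (bcomul B b)"
    and \<phi>: "\<And>b. rho E (\<phi> b) = tmap B B E B \<phi> id (bcomul B b)"
    and \<kappa>: "lin E ground \<kappa>" "\<And>b. \<kappa> (\<psi> b) = bcounit B b"
  shows "\<phi> b = SB b (\<lambda>x y. scale E (\<kappa> (\<phi> x)) (\<psi> y))"
proof -
  have F: "bilin E B E (\<lambda>e c. scale E (\<kappa> e) (\<psi> c))"
    by (intro lin_intros lin_compose[OF \<kappa>(1)] lin_compose[OF \<psi>(1)])
  obtain c where c: "\<phi> b = \<psi> c" using \<psi>(2) by (metis surjD)
  have "SE (\<psi> c) (\<lambda>e c. scale E (\<kappa> e) (\<psi> c)) = \<psi> c"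
    unfolding SE_colinear[OF \<psi>(3) F] \<kappa>(2) by (rule bcounit_left[OF \<psi>(1)])
  then show ?thesis unfolding c[symmetric] SE_colinear[OF \<phi> F] by simp
qed

text \<open>With \<open>\<omega>\<close> equal to \<open>f'\<close> convolved with
  \<open>\<gamma>\<close>, and \<open>\<gamma>\<close> equal to \<open>f\<close> convolved with
  \<open>\<omega>\<close>, an inverse of \<open>\<omega>\<close> is \<open>\<gamma>'\<close>
  convolved with \<open>f\<close>.\<close>

lemma colinear_iso_conv_invertible:
  assumes \<gamma>: "lin B E \<gamma>" "bij \<gamma>" "\<And>b. rho E (\<gamma> b) = tmap B B E B \<gamma> id (bcomul B b)"
      "conv_invertible B E \<gamma>"
    and \<omega>: "lin B E \<omega>" "bij \<omega>" "\<And>b. rho E (\<omega> b) = tmap B B E B \<omega> id (bcomul B b)"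
  shows "conv_invertible B E \<omega>"
proof -
  obtain \<gamma>' where \<gamma>': "lin B E \<gamma>'"
    "\<And>b. SB b (\<lambda>x y. cmul E (\<gamma> x) (\<gamma>' y)) = scale E (bcounit B b) (cone E)"
    "\<And>b. SB b (\<lambda>x y. cmul E (\<gamma>' x) (\<gamma> y)) = scale E (bcounit B b) (cone E)"
    using \<gamma>(4) by (auto simp: conv_invertible_def)
  have lin_inv: "lin E B (inv f)" if "lin B E f" "bij f" for f
    using that by (auto simp: lin_iff)
      (metis bij_inv_eq_iff)+
  define \<kappa> where "\<kappa> e = bcounit B (inv \<omega> e)" for e
  define \<kappa>' where "\<kappa>' e = bcounit B (inv \<gamma> e)" for e
  have \<kappa>: "lin E ground \<kappa>" "\<And>b. \<kappa> (\<omega> b) = bcounit B b"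
    unfolding \<kappa>_def using lin_inv[OF \<omega>(1,2)] \<omega>(2)
    by (auto intro!: lin_intros simp: bij_is_inj)
  have \<kappa>': "lin E ground \<kappa>'" "\<And>b. \<kappa>' (\<gamma> b) = bcounit B b"
    unfolding \<kappa>'_def using lin_inv[OF \<gamma>(1,2)] \<gamma>(2)
    by (auto intro!: lin_intros simp: bij_is_inj)
  define f where "f b = \<kappa> (\<gamma> b)" for b
  define f' where "f' b = \<kappa>' (\<omega> b)" for b
  have lf: "lin B ground f" "lin B ground f'"
    unfolding f_def[abs_def] f'_def[abs_def]
        by (intro lin_compose[OF \<kappa>(1)] lin_compose[OF \<kappa>'(1)] \<gamma> \<omega>)+
  note li = lin_intros lf[THEN lin_compose] \<gamma>(1)[THEN lin_compose] \<omega>(1)[THEN lin_compose]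
    \<gamma>'(1)[THEN lin_compose]
  have \<gamma>_eq: "\<gamma> b = SB b (\<lambda>x y. scale E (f x) (\<omega> y))" for b
    unfolding f_def by (rule colinear_iso_change[OF \<omega>(1) bij_is_surj[OF \<omega>(2)] \<omega>(3) \<gamma>(3) \<kappa>])
  have \<omega>_eq: "\<omega> b = SB b (\<lambda>x y. scale E (f' x) (\<gamma> y))" for b
    unfolding f'_def by (rule colinear_iso_change[OF \<gamma>(1) bij_is_surj[OF \<gamma>(2)] \<gamma>(3) \<omega>(3) \<kappa>'])
  \<comment> \<open>Applying \<open>\<kappa>\<close> to the expansion of \<open>\<omega>\<close>
    turns its left side into the counit.\<close>
  have f'f: "SB b (\<lambda>x y. f' x * f y) = bcounit B b" for b
    using arg_cong[OF \<omega>_eq[of b], of \<kappa>]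
    by (simp add: \<kappa>(2) lin_sweedler[OF \<kappa>(1)] lin_scale[OF \<kappa>(1)] f_def ground_def)
  define \<omega>' where "\<omega>' b = SB b (\<lambda>x y. scale E (f y) (\<gamma>' x))" for b
  have \<omega>\<gamma>': "SB w (\<lambda>x y. cmul E (\<omega> x) (\<gamma>' y)) = scale E (f' w) (cone E)" for w
  proof -
    have "SB w (\<lambda>x y. cmul E (\<omega> x) (\<gamma>' y))
        = SB w (\<lambda>x y. SB x (\<lambda>u v. scale E (f' u) (cmul E (\<gamma> v) (\<gamma>' y))))"
      unfolding \<omega>_eq by (simp only: cmul_sweedler cmul_scale)
    also have "\<dots> = SB w (\<lambda>u z. SB z (\<lambda>v y. scale E (f' u) (cmul E (\<gamma> v) (\<gamma>' y))))"
      by (intro coassoc[where D = E] li)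
    also have "\<dots> = SB w (\<lambda>u z. scale E (f' u) (SB z (\<lambda>v y. cmul E (\<gamma> v) (\<gamma>' y))))"
      by (intro sweedler_cong lin_sweedler[where C = E and D = E, symmetric] li)
    also have "\<dots> = SB w (\<lambda>u z. scale E (bcounit B z) (scale E (f' u) (cone E)))"
      by (simp only: \<gamma>' scale_scale[OF vspace_E] mult.commute)
    also have "\<dots> = scale E (f' w) (cone E)"
      by (rule bcounit_right) (intro li)
    finally show ?thesis .
  qed
  show ?thesis unfolding conv_invertible_def
  proof (intro exI[of _ \<omega>'] conjI allI)
    show "lin B E \<omega>'" unfolding \<omega>'_def[abs_def] by (intro li)
    fix b
    have "SB b (\<lambda>x y. cmul E (\<omega> x) (\<omega>' y))
        = SB b (\<lambda>x w. SB w (\<lambda>y z. scale E (f z) (cmul E (\<omega> x) (\<gamma>' y))))"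
      unfolding \<omega>'_def by (simp only: cmul_sweedler cmul_scale)
    also have "\<dots> = SB b (\<lambda>w z. SB w (\<lambda>x y. scale E (f z) (cmul E (\<omega> x) (\<gamma>' y))))"
      by (rule coassoc[where D = E, symmetric]) (intro li)
    also have "\<dots> = SB b (\<lambda>w z. scale E (f z) (SB w (\<lambda>x y. cmul E (\<omega> x) (\<gamma>' y))))"
      by (intro sweedler_cong lin_sweedler[where C = E and D = E, symmetric] li)
    also have "\<dots> = SB b (\<lambda>w z. scale E (f' w * f z) (cone E))"
      by (simp only: \<omega>\<gamma>' scale_scale[OF vspace_E] mult.commute)
    also have "\<dots> = scale E (SB b (\<lambda>w z. f' w * f z)) (cone E)"
      by (rule lin_sweedler[where C = ground and D = E, symmetric]) (intro li)
    finally show "SB b (\<lambda>x y. cmul E (\<omega> x) (\<omega>' y)) = scale E (bcounit B b) (cone E)"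
      by (simp only: f'f)
    have "SB b (\<lambda>x y. cmul E (\<omega>' x) (\<omega> y))
        = SB b (\<lambda>w z. SB w (\<lambda>x y. scale E (f y) (cmul E (\<gamma>' x) (\<omega> z))))"
      unfolding \<omega>'_def by (simp only: cmul_sweedler cmul_scale)
    also have "\<dots> = SB b (\<lambda>x w. SB w (\<lambda>y z. scale E (f y) (cmul E (\<gamma>' x) (\<omega> z))))"
      by (rule coassoc[where D = E]) (intro li)
    also have "\<dots> = SB b (\<lambda>x w. cmul E (\<gamma>' x) (\<gamma> w))"
      unfolding \<gamma>_eq by (simp only: cmul_sweedler cmul_scale)
    finally show "SB b (\<lambda>x y. cmul E (\<omega>' x) (\<omega> y)) = scale E (bcounit B b) (cone E)"
      by (simp only: \<gamma>')
  qed
qed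

section \<open>Slices of the coaction and the defect of colinearity\<close>

definition slice :: "('e \<Rightarrow> 'k) \<Rightarrow> 'e \<Rightarrow> 'b" where
  "slice \<phi> e = SE e (\<lambda>e0 b. scale B (\<phi> e0) b)"

lemma lin_slice:
  assumes "lin E ground \<phi>" shows "lin E B (slice \<phi>)"
  unfolding slice_def[abs_def] by (intro lin_intros lin_compose[OF assms])

text \<open>Coassociativity of \<open>\<rho>\<close> makes each slice
  \<open>(\<phi> \<otimes> id) \<rho>\<close> colinear into \<open>B\<close>; \<open>F\<close> tests
  the resulting equality of tensors.\<close>

lemma slice_colinear:
  assumes \<phi>: "lin E ground \<phi>" and F: "bilin B B D F"
  shows "SB (slice \<phi> e) F = SE e (\<lambda>e' c. F (slice \<phi> e') c)"
proof -
  note li = lin_intros lin_compose[OF \<phi>] F[THEN bilin_lin_left] F[THEN bilin_lin_right]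
  have lin1: "lin B D (\<lambda>z. SB z F)" and lin2: "\<And>c. lin B D (\<lambda>b. F b c)" by (intro li F)+
  have D: "vspace D" using bilin_dom[OF F] by simp
  have "SB (slice \<phi> e) F = SE e (\<lambda>e0 b. scale D (\<phi> e0) (SB b F))"
    unfolding slice_def lin_sweedler[OF lin1] lin_scale[OF lin1] ..
  also have "\<dots> = SE e (\<lambda>e0 b. SB b (\<lambda>u v. scale D (\<phi> e0) (F u v)))"
    by (intro sweedler_cong lin_sweedler[where C = D and D = D] lin_scale_right lin_ident D)
  also have "\<dots> = SE e (\<lambda>e' c. SE e' (\<lambda>e0 b. scale D (\<phi> e0) (F b c)))"
    by (rule rho_coassoc[where D = D, symmetric]) (intro li D)
  also have "\<dots> = SE e (\<lambda>e' c. F (slice \<phi> e') c)"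
    unfolding slice_def lin_sweedler[OF lin2] lin_scale[OF lin2] ..
  finally show ?thesis .
qed

definition colinear_defect :: "('b \<Rightarrow> 'e) \<Rightarrow> 'b \<Rightarrow> ('k, 'e, 'b) tensor" where
  "colinear_defect l b = rho E (l b) - tmap B B E B l id (bcomul B b)"

lemma colinear_defect_tspace: "colinear_defect l b \<in> tspace E B"
  unfolding colinear_defect_def tmap_def
  by (intro tspace_diff rho_tspace tspace_sweedler tens_in_tspace vspace_E vspace_B)

lemma lin_colinear_defect:
  assumes "lin B E l" shows "lin B TT (colinear_defect l)"
  unfolding colinear_defect_def[abs_def] tmap_def id_apply
  by (intro lin_intros lin_compose[OF assms])

lemma sweedler_colinear_defect:
  assumes "bilin E B D F"
  shows "sweedler E B (colinear_defect l b) F = SE (l b) F - SB b (\<lambda>x y. F (l x) y)"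
proof -
  have "tmap B B E B l id (bcomul B b) \<in> tspace E B"
    unfolding tmap_def by (intro tspace_sweedler tens_in_tspace vspace_E vspace_B)
  then show ?thesis
    by (simp add: colinear_defect_def sweedler_minus[OF assms] rho_tspace)
      (simp add: tmap_def sweedler_bind[OF assms] tens_in_tspace sweedler_tens[OF assms])
qed

text \<open>The core of the argument, free of the pre-Nichols algebra: \<open>c1\<close> and
  \<open>c2\<close> are the two conditions expressed through the defect of \<open>l\<close>, and
  subtracting \<open>l n\<close> repairs colinearity.\<close>

lemma colinear_correction:
  assumes l: "lin B E l" "bij l" "l (bone B) = cone E"
    and \<epsilon>0: "lin E ground \<epsilon>0" "\<And>b. \<epsilon>0 (l b) = bcounit B b"
    and c1: "\<And>b. tmap E B E B (\<lambda>e. l (slice \<epsilon>0 e)) id (colinear_defect l b) = colinear_defect l b"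
    and c2: "\<And>b. colinear_defect l (slice \<epsilon>0 (l b) - b) = 0"
    and \<omega>: "\<And>b. \<omega> b = l b - l (slice \<epsilon>0 (l b) - b)"
  shows "bij \<omega>" "\<omega> (bone B) = cone E" "\<epsilon>0 (\<omega> b) = bcounit B b"
    "rho E (\<omega> b) = tmap B B E B \<omega> id (bcomul B b)"
proof -
  define n where "n b = slice \<epsilon>0 (l b) - b" for b
  note li = lin_intros lin_compose[OF l(1)] lin_compose[OF \<epsilon>0(1)] lin_compose[OF lin_slice[OF
      \<epsilon>0(1)]]
  have ln: "lin B B n" unfolding n_def[abs_def] by (intro li)
  have \<omega>n: "\<omega> b = l (b - n b)" for b by (simp add: \<omega> n_def lin_diff[OF l(1)])
  have bF: "bilin E B B (\<lambda>e c. scale B (\<epsilon>0 e) c)" by (intro li)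
  \<comment> \<open>The map \<open>n\<close> is \<open>\<epsilon>0 \<otimes> id\<close> applied to
    the defect, so \<open>c2\<close> makes it square to zero.\<close>
  have n_eq: "n b = sweedler E B (colinear_defect l b) (\<lambda>e c. scale B (\<epsilon>0 e) c)" for b
    unfolding n_def sweedler_colinear_defect[OF bF] slice_def \<epsilon>0(2)
    by (subst bcounit_left) (auto intro: li)
  have nn: "n (n b) = 0" for b
    using n_eq[of "n b"] c2[of b] sweedler_eq[OF bF, of 0 "[]"] by (simp flip: n_def)
  \<comment> \<open>Since \<open>n\<close> squares to zero, \<open>id + n\<close> inverts
    \<open>id - n\<close>.\<close>
  have "bij (\<lambda>b. b - n b)"
    by (rule o_bij[of "\<lambda>b. b + n b"]) (auto simp: fun_eq_iff lin_diff[OF ln] lin_add[OF ln] nn)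
  from bij_comp[OF this l(2)] show "bij \<omega>"
    by (simp add: comp_def \<omega>n[abs_def])
  have "slice \<epsilon>0 (cone E) = bone B"
    unfolding slice_def rho_cone sweedler_tens[OF bF]
    using \<epsilon>0(2)[of "bone B"] by (simp add: l(3) bcounit_bone scale_one)
  then have "n (bone B) = 0" by (simp add: n_def l(3))
  then show "\<omega> (bone B) = cone E" by (simp add: \<omega>n l(3))
  have "bcounit B (slice \<epsilon>0 (l b)) = SE (l b) (\<lambda>e c. scale ground (bcounit B c) (\<epsilon>0 e))"
    unfolding slice_def lin_sweedler[OF lin_bcounit] lin_scale[OF lin_bcounit]
    by (simp add: ground_def mult.commute)
  also have "\<dots> = bcounit B b" by (simp add: rho_counit[OF \<epsilon>0(1)] \<epsilon>0(2))
  finally have "bcounit B (n b) = 0" by (simp add: n_def lin_diff[OF lin_bcounit])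
  then show "\<epsilon>0 (\<omega> b) = bcounit B b"
    by (simp add: \<omega>n \<epsilon>0(2) lin_diff[OF lin_bcounit])
  have bT: "bilin B B TT (\<lambda>x y. tens E B (l x) y)" by (intro li)
  have bS: "bilin E B TT (\<lambda>e y. tens E B (l (slice \<epsilon>0 e)) y)" by (intro li)
  have diff: "tens E B (u - v) y = tens E B u y - tens E B v y" for u v y
    using lin_diff[of E TT "\<lambda>u. tens E B u y"] bilin_tens[of E B] by (simp add: bilin_def)
  have lS: "lin B TT (\<lambda>b. SB b (\<lambda>x y. tens E B (l x) y))" by (intro li)
  have sn: "slice \<epsilon>0 (l x) = n x + x" for x by (simp add: n_def)
  \<comment> \<open>Expanding the left side of \<open>c1\<close>, with colinearity of the slice,
    expresses the defect through \<open>l\<close>, \<open>n\<close> and coproducts only.\<close>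
  have "colinear_defect l b = SE (l b) (\<lambda>e c. tens E B (l (slice \<epsilon>0 e)) c)
      - SB b (\<lambda>x y. tens E B (l (slice \<epsilon>0 (l x))) y)"
    using c1[of b] by (simp add: tmap_def sweedler_colinear_defect[OF bS])
  also have "SE (l b) (\<lambda>e c. tens E B (l (slice \<epsilon>0 e)) c)
      = SB (slice \<epsilon>0 (l b)) (\<lambda>x y. tens E B (l x) y)"
    by (rule slice_colinear[OF \<epsilon>0(1) bT, symmetric])
  also have "\<dots> = SB (n b) (\<lambda>x y. tens E B (l x) y) + SB b (\<lambda>x y. tens E B (l x) y)"
    by (simp only: sn lin_add[OF lS])
  finally have Y: "colinear_defect l b = SB (n b) (\<lambda>x y. tens E B (l x) y)
      + SB b (\<lambda>x y. tens E B (l x) y) - SB b (\<lambda>x y. tens E B (l (slice \<epsilon>0 (l x))) y)" .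
  \<comment> \<open>By \<open>c2\<close> the defect of \<open>l\<close> vanishes on the range of
    \<open>n\<close>. This is the term that cancels against \<open>Y\<close>.\<close>
  have "rho E (l (n b)) = SB (n b) (\<lambda>x y. tens E B (l x) y)"
    using c2[of b] by (simp add: colinear_defect_def tmap_def flip: n_def)
  then have "rho E (\<omega> b) = rho E (l b) - SB (n b) (\<lambda>x y. tens E B (l x) y)"
    by (simp add: \<omega>n lin_diff[OF l(1)] lin_diff[OF lin_rho])
  also have "\<dots> = SB b (\<lambda>x y. tens E B (l x) y) - SB b (\<lambda>x y. tens E B (l (n x)) y)"
    using Y by (simp add: colinear_defect_def tmap_def n_def lin_diff[OF l(1)] diff sweedler_diff
        algebra_simps)
  also have "\<dots> = tmap B B E B \<omega> id (bcomul B b)"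
    by (simp add: tmap_def \<omega>n lin_diff[OF l(1)] diff sweedler_diff)
  finally show "rho E (\<omega> b) = tmap B B E B \<omega> id (bcomul B b)" .
qed

end

section \<open>Noncommutative polynomials in graded algebras\<close>

lemma alg_hom_nc_eval:
  assumes "alg_hom A m u C m' u' f"
  shows "f (nc_eval A m u z p) = nc_eval C m' u' (\<lambda>i. f (z i)) p"
proof -
  have l: "lin A C f" and m: "\<And>a b. f (m a b) = m' (f a) (f b)" "f u = u'"
    using assms by (auto simp: alg_hom_def)
  have "f (\<Sum>x\<in>S. g x) = (\<Sum>x\<in>S. f (g x))" if "finite S" for S :: "nat list set" and g
    using that by (induction S) (auto simp: lin_zero[OF l] lin_add[OF l])
  moreover have "f (foldr (\<lambda>i. m (z i)) w u) = foldr (\<lambda>i. m' (f (z i))) w u'" for w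
    by (induction w) (auto simp: m)
  ultimately show ?thesis by (simp add: nc_eval_def lin_scale[OF l])
qed

lemma nc_eval_degree_0:
  assumes "nc_homogeneous \<theta> 0 p" "vspace A"
  shows "nc_eval A m u z p = scale A (Poly_Mapping.lookup p []) u"
proof -
  interpret vector_space "scale A" using assms(2) by (simp add: vspace_def)
  have "Poly_Mapping.keys p \<subseteq> {[]}" using assms(1) by (auto simp: nc_homogeneous_def)
  then consider "Poly_Mapping.keys p = {}" | "Poly_Mapping.keys p = {[]}" by blast
  then show ?thesis
  proof cases
    \<comment> \<open>The zero polynomial is homogeneous of every degree; its coefficient at the
      empty word is 0.\<close>
    case 1
    then have "Poly_Mapping.lookup p [] = 0" by (simp add: in_keys_iff)
    with 1 show ?thesis by (simp add: nc_eval_def)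
  qed (simp add: nc_eval_def)
qed

lemma nc_eval_grade:
  assumes A: "graded_braided_hopf H A" and z: "\<And>i. i \<in> {1..\<theta>} \<Longrightarrow> z i \<in> grade A 1"
    and p: "nc_homogeneous \<theta> n p"
  shows "nc_eval A (bmul A) (bone A) z p \<in> grade A n"
proof -
  have vs: "vspace A" using A by (simp add: graded_braided_hopf_def braided_hopf_def coalgebra_def)
  interpret vector_space "scale A" using vs by (simp add: vspace_def)
  have sub: "subspace (grade A n)" and one: "bone A \<in> grade A 0"
    and mul: "\<And>i j a b. a \<in> grade A i \<Longrightarrow> b \<in> grade A j \<Longrightarrow> bmul A a b \<in> grade A (i + j)" for n
    using A by (auto simp: graded_braided_hopf_def is_subspace_def)
  have "foldr (\<lambda>i. bmul A (z i)) w (bone A) \<in> grade A (length w)" if "set w \<subseteq> {1..\<theta>}" for w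
    using that by (induction w) (use one mul[of _ 1] z in auto)
  then show ?thesis
    using p unfolding nc_eval_def nc_homogeneous_def
    by (intro subspace_sum subspace_scale sub) auto
qed

lemma lin_in_subspace_on_basis:
  assumes "is_basis A S" "lin A C f" "is_subspace C W" "\<And>b. b \<in> S \<Longrightarrow> f b \<in> W"
  shows "f x \<in> W"
proof -
  interpret vector_space_pair "scale A" "scale C"
    using assms(2) by (simp add: lin_iff vspace_def vector_space_pair_def)
  have l: "Vector_Spaces.linear (scale A) (scale C) f" using assms(2) by (simp add: lin_def)
  have "f x \<in> f ` vs1.span S" using assms(1) by (simp add: is_basis_def vspan_def)
  also have "\<dots> = vs2.span (f ` S)" by (rule linear_span_image[OF l, symmetric])
  also have "\<dots> \<subseteq> W" using assms(3,4) by (intro vs2.span_minimal) (auto simp: is_subspace_def)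
  finally show ?thesis .
qed

theorem theorem3p6:
  fixes H :: "('k::{alg_closed_field, field_char_0}, 'h::ab_group_add) hopf"
    and V :: "('k, 'h, 'v::ab_group_add) ydmod"
    and \<theta> :: nat and x :: "nat \<Rightarrow> 'v"
    and T :: "('k, 'h, 't::ab_group_add) bhopf" and jT :: "'v \<Rightarrow> 't"
    and B :: "('k, 'h, 'b::ab_group_add) bhopf" and jB :: "'v \<Rightarrow> 'b"
    and Bh :: "('k, 'h, 'a::ab_group_add) bhopf" and q :: "'t \<Rightarrow> 'a"
    and E :: "('k, 'h, 'e::ab_group_add, 'b) comod_alg"
    and \<pi>B :: "'a \<Rightarrow> 'b" and \<pi>E :: "'a \<Rightarrow> 'e"
    and xh :: "nat \<Rightarrow> 'a" and y :: "nat \<Rightarrow> 'e"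
    and BB :: "'b set" and p :: "'b \<Rightarrow> 'k ncpoly"
    and l :: "'b \<Rightarrow> 'e" and \<epsilon>0 :: "'e \<Rightarrow> 'k" and \<iota> :: "'b \<Rightarrow> 'a"
    and \<tau>1 \<tau>2 :: "'a \<Rightarrow> 'a"
    and rD :: "'a \<Rightarrow> ('k, 'a, 'a) tensor"
    and \<epsilon>0l :: "('k, 'e, 'b) tensor \<Rightarrow> 'e" and X :: "'a \<Rightarrow> ('k, 'e, 'b) tensor"
    and \<omega> :: "'b \<Rightarrow> 'e" and \<sigma> :: "'b \<Rightarrow> 'b \<Rightarrow> 'k"
  assumes "hopf_algebra H" and "bij (hantip H)"
    and "yd_module H V" and "family_basis V {1..\<theta>} x"
    and "nichols_algebra H V B jB"
    and "cleft_object H B E"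
    and "tensor_algebra H V \<theta> x T jT" and "pre_nichols H T jT B jB Bh q \<pi>B"
    and "alg_hom Bh (bmul Bh) (bone Bh) E (cmul E) (cone E) \<pi>E" and "surj \<pi>E"
    and "\<forall>a. rho E (\<pi>E a) = tmap Bh Bh E B \<pi>E \<pi>B (bcomul Bh a)"
    and xh: "\<And>i. xh i = q (jT (x i))" and y: "\<And>i. y i = \<pi>E (xh i)"
    and "is_basis B BB" and "\<forall>b\<in>BB. \<exists>n. b \<in> grade B n"
    and "\<forall>b\<in>BB. \<exists>n. nc_homogeneous \<theta> n (p b)"
    and "\<forall>b\<in>BB. b = nc_eval B (bmul B) (bone B) (\<lambda>i. jB (x i)) (p b)"
    and "family_basis E BB (\<lambda>b. nc_eval E (cmul E) (cone E) y (p b))"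
    and "lin B E l" and "\<forall>b\<in>BB. l b = nc_eval E (cmul E) (cone E) y (p b)"
    and "lin E ground \<epsilon>0" and "\<forall>b. \<epsilon>0 (l b) = bcounit B b"
    and "lin B Bh \<iota>" and "\<forall>b\<in>BB. \<iota> b = nc_eval Bh (bmul Bh) (bone Bh) xh (p b)"
    and "\<forall>a. a = \<tau>1 a + \<tau>2 a \<and> \<tau>1 a \<in> range \<iota> \<and> \<pi>B (\<tau>2 a) = 0"
    and "reduced_comul Bh rD"
    and \<epsilon>0l: "\<And>t. \<epsilon>0l t = sweedler E B t (\<lambda>e b. scale E (\<epsilon>0 e) (l b))"
    and X: "\<And>a. X a = tmap Bh Bh E B (\<lambda>u. \<pi>E (\<tau>2 u)) \<pi>B (rD a)"
    and cond1: "\<forall>b\<in>BB. tmap E B E B (\<lambda>e. \<epsilon>0l (rho E e)) id (X (\<iota> b)) = X (\<iota> b)"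
    and cond2: "\<forall>b\<in>BB. sweedler Bh Bh (rD (\<iota> b))
                  (\<lambda>u v. scale TT (\<epsilon>0 (\<pi>E (\<tau>2 u))) (X (\<tau>1 v))) = 0"
    and "lin B E \<omega>" and "\<forall>b\<in>BB. \<omega> b = l b - \<epsilon>0l (X (\<iota> b))"
    and \<sigma>: "\<And>a b. \<sigma> a b = \<epsilon>0 (cmul E (\<omega> a) (\<omega> b))"
    and "h_linear B E \<omega>"
  shows "\<sigma> \<in> Z2 H B \<and> comod_alg_iso B E (cocycle_twist H B \<sigma>)"
proof -
  note nich = assms(5) and cleft = assms(6) and pre = assms(8) and homE = assms(9)
    and basis = assms(14)
  interpret braided_comodule_algebra H B E
    by unfold_locales
      (use assms(1) nich cleft in \<open>auto simp: nichols_algebra_def graded_braided_hopf_def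
          cleft_object_def\<close>)
  interpret A: braided_hopf_pair H Bh
    by unfold_locales (use assms(1) pre in \<open>auto simp: pre_nichols_def graded_braided_hopf_def\<close>)
  have grA: "graded_braided_hopf H Bh" and grB: "graded_braided_hopf H B"
    using pre nich by (auto simp: pre_nichols_def nichols_algebra_def)
  have homB: "graded_bhopf_hom H Bh B \<pi>B" and homT: "graded_bhopf_hom H T Bh q"
    using pre by (auto simp: pre_nichols_def)
  have algB: "alg_hom Bh (bmul Bh) (bone Bh) B (bmul B) (bone B) \<pi>B"
    using homB by (simp add: graded_bhopf_hom_def)
  have lin_\<pi>B: "lin Bh B \<pi>B" and lin_\<pi>E: "lin Bh E \<pi>E"
    using algB homE by (auto simp: alg_hom_def)
  note lin_l = assms(19) and lin_\<epsilon>0 = assms(21) and \<epsilon>0_l = assms(22)[rule_format]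
    and lin_\<iota> = assms(23)

  \<comment> \<open>Generators, the projections restricted to the range of \<open>\<iota>\<close>,
    and the unit\<close>
  have xh_grade: "xh i \<in> grade Bh 1" if "i \<in> {1..\<theta>}" for i
  proof -
    interpret T: vector_space "scale T"
      using assms(7) by (simp add: tensor_algebra_def graded_braided_hopf_def braided_hopf_def
          coalgebra_def vspace_def)
    \<comment> \<open>Degree one of the tensor algebra is spanned by one-letter words, so
      \<open>jT (x i)\<close> is recognized as the word \<open>[i]\<close>; then \<open>q\<close>
      preserves its degree.\<close>
    let ?word = "\<lambda>w. foldr (\<lambda>i. bmul T (jT (x i))) w (bone T)"
    have "grade T 1 = vspan T (?word ` {w. set w \<subseteq> {1..\<theta>} \<and> length w = 1})"
      using assms(7) unfolding tensor_algebra_def Let_def by blast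
    moreover have "?word [i] \<in> vspan T (?word ` {w. set w \<subseteq> {1..\<theta>} \<and> length w = 1})"
      unfolding vspan_def by (rule T.span_base, rule imageI) (use that in auto)
    moreover have "?word [i] = jT (x i)"
      using assms(7) by (simp add: tensor_algebra_def graded_braided_hopf_def braided_hopf_def
          h_module_algebra_def assoc_algebra_def)
    ultimately have "jT (x i) \<in> grade T 1" by metis
    then show ?thesis using homT unfolding xh graded_bhopf_hom_def by blast
  qed
  have \<pi>B_xh: "\<pi>B (xh i) = jB (x i)" for i using pre by (simp add: xh pre_nichols_def)
  have \<pi>B_\<iota>: "\<pi>B (\<iota> b) = b" for b
    by (rule lin_eq_on_basis[OF basis, of B])
      (auto intro!: lin_compose[OF lin_\<pi>B] lin_\<iota> lin_ident simp: assms(24) alg_hom_nc_eval[OF algB]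
        \<pi>B_xh assms(17)[rule_format, symmetric])
  have \<pi>E_\<iota>: "\<pi>E (\<iota> b) = l b" for b
    by (rule lin_eq_on_basis[OF basis, of E])
      (auto intro!: lin_compose[OF lin_\<pi>E] lin_\<iota> lin_l simp: assms(20,24) alg_hom_nc_eval[OF homE]
          y[symmetric])
  have bij_l: "bij l"
  proof (rule bij_on_family_basis[OF basis lin_l])
    show "inj_on l BB" using assms(18,20) by (simp add: family_basis_def inj_on_def)
    have "l ` BB = (\<lambda>b. nc_eval E (cmul E) (cone E) y (p b)) ` BB"
      using assms(20) by (intro image_cong) auto
    then show "is_basis E (l ` BB)" using assms(18) by (simp add: family_basis_def)
  qed

  \<comment> \<open>The reduced coproduct is prescribed separately in degree 0 and in positive
    degree, hence this case split.\<close>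
  have \<iota>_cases: "(\<exists>c. \<iota> b = scale Bh c (bone Bh)) \<or> (\<exists>n>0. \<iota> b \<in> grade Bh n)" if b: "b \<in> BB" for b
  proof -
    obtain n where n: "nc_homogeneous \<theta> n (p b)" using assms(16) b by blast
    show ?thesis
    proof (cases "n = 0")
      case True
      then show ?thesis using nc_eval_degree_0[of \<theta> "p b" Bh] n assms(24) b by auto
    next
      case False
      then show ?thesis using nc_eval_grade[OF grA xh_grade n] assms(24) b by auto
    qed
  qed
  \<comment> \<open>Some basis element has nonzero counit, as the counit is not zero. Its degree
    must be 0, so it is a nonzero multiple of the unit, and linearity of \<open>\<iota>\<close>
    allows division by the scalar.\<close>
  have \<iota>_one: "\<iota> (bone B) = bone Bh"
  proof -
    have "\<exists>b\<in>BB. bcounit B b \<noteq> 0"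
    proof (rule ccontr)
      assume "\<not> ?thesis"
      moreover have "lin B ground (\<lambda>_. 0)"
          by (simp add: lin_iff vspace_ground) (simp add: ground_def)
      ultimately have "bcounit B (bone B) = 0"
        using lin_eq_on_basis[OF basis lin_bcounit, of "\<lambda>_. 0"] by blast
      then show False by (simp add: bcounit_bone)
    qed
    then obtain b where b: "b \<in> BB" "bcounit B b \<noteq> 0" by blast
    have "\<exists>c. \<iota> b = scale Bh c (bone Bh)"
    proof (rule ccontr)
      assume "\<not> ?thesis"
      then obtain n where n: "n > 0" "\<iota> b \<in> grade Bh n" using \<iota>_cases[OF b(1)] by blast
      then have "\<pi>B (\<iota> b) \<in> grade B n" using homB unfolding graded_bhopf_hom_def by blast
      then show False using n(1) b(2) grB by (simp add: \<pi>B_\<iota> graded_braided_hopf_def)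
    qed
    then obtain c where c: "\<iota> b = scale Bh c (bone Bh)" by blast
    have "b = \<pi>B (scale Bh c (bone Bh))" using c \<pi>B_\<iota>[of b] by simp
    also have "\<dots> = scale B c (bone B)" using algB by (simp add: lin_scale[OF lin_\<pi>B] alg_hom_def)
    finally have b1: "b = scale B c (bone B)" .
    then have "c \<noteq> 0" using b(2) by (auto simp: lin_scale[OF lin_bcounit] ground_def)
    have "scale Bh c (\<iota> (bone B)) = scale Bh c (bone Bh)"
      using c unfolding b1 lin_scale[OF lin_\<iota>] .
    then have "scale Bh (inverse c) (scale Bh c (\<iota> (bone B)))
        = scale Bh (inverse c) (scale Bh c (bone Bh))"
      by simp
    then show ?thesis using \<open>c \<noteq> 0\<close> by (simp add: scale_scale scale_one)
  qed
  have l_one: "l (bone B) = cone E"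
    using homE by (simp flip: \<pi>E_\<iota> add: \<iota>_one alg_hom_def)

  \<comment> \<open>The map \<open>\<pi>E \<tau>2\<close> and the reduced coproduct\<close>
  define \<delta> where "\<delta> u = \<pi>E (\<tau>2 u)" for u
  have \<tau>1: "\<tau>1 a = \<iota> (\<pi>B a)" for a
  proof -
    obtain c where c: "\<tau>1 a = \<iota> c" using assms(25) by blast
    have "\<pi>B a = \<pi>B (\<tau>1 a) + \<pi>B (\<tau>2 a)" using assms(25) lin_add[OF lin_\<pi>B] by metis
    then show ?thesis using assms(25) by (simp add: c \<pi>B_\<iota>)
  qed
  have \<delta>: "\<delta> u = \<pi>E u - l (\<pi>B u)" for u
  proof -
    have "u = \<tau>1 u + \<tau>2 u" using assms(25) by blast
    then have "\<pi>E u = \<pi>E (\<tau>1 u) + \<delta> u" unfolding \<delta>_def using lin_add[OF lin_\<pi>E] by metis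
    then show ?thesis by (simp add: \<tau>1 \<pi>E_\<iota>)
  qed
  have lin_\<delta>: "lin Bh E \<delta>"
    unfolding \<delta>[abs_def] by (intro lin_sub lin_\<pi>E lin_compose[OF lin_l] lin_\<pi>B)
  have \<delta>_\<iota>: "\<delta> (\<iota> b) = 0" for b by (simp add: \<delta> \<pi>E_\<iota> \<pi>B_\<iota>)
  have \<delta>_one: "\<delta> (bone Bh) = 0" using \<delta>_\<iota>[of "bone B"] by (simp add: \<iota>_one)

  have rD: "lin Bh TT rD" "\<And>n a. n > 0 \<Longrightarrow> a \<in> grade Bh n \<Longrightarrow>
      rD a = bcomul Bh a - tens Bh Bh a (bone Bh) - tens Bh Bh (bone Bh) a"
    "\<And>a. a \<in> grade Bh 0 \<Longrightarrow> rD a = 0"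
    using assms(26) by (auto simp: reduced_comul_def)
  have rD_one: "rD (bone Bh) = 0" using grA by (intro rD) (simp add: graded_braided_hopf_def)
  \<comment> \<open>The arbitrary bilinear \<open>F\<close> lets one computation serve both
    conditions: with \<open>tens E B\<close> it identifies \<open>X\<close>, with a
    \<open>TT\<close>-valued form it evaluates the second condition.\<close>
  have rD_\<iota>: "rD (\<iota> b) \<in> tspace Bh Bh
      \<and> sweedler Bh Bh (rD (\<iota> b)) (\<lambda>u v. F (\<delta> u) (\<pi>B v)) = SE (l b) F - SB b (\<lambda>x y. F (l x) y)"
    if b: "b \<in> BB" and F: "bilin E B D F" for b and D :: "('k, 'd::ab_group_add) vect" and F
  proof -
    let ?\<Phi> = "\<lambda>u v. F (\<delta> u) (\<pi>B v)"
    have bG: "bilin Bh Bh D (\<lambda>u v. F (f u) (\<pi>B v))" if "lin Bh E f" for f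
      by (intro bilinI bilin_lin_left[OF F] bilin_lin_right[OF F] lin_\<pi>B that)
    have F0: "F 0 v = 0" for v using F lin_zero[of E D "\<lambda>e. F e v"] by (simp add: bilin_def)
    have b\<Phi>: "bilin Bh Bh D ?\<Phi>" by (rule bG[OF lin_\<delta>])
    have "rD (\<iota> b) \<in> tspace Bh Bh \<and> sweedler Bh Bh (rD (\<iota> b)) ?\<Phi> = A.SB (\<iota> b) ?\<Phi>"
      using \<iota>_cases[OF b]
    proof (elim disjE exE conjE)
      fix c assume c: "\<iota> b = scale Bh c (bone Bh)"
      have "rD (\<iota> b) = 0" unfolding c lin_scale[OF rD(1)] rD_one
        by (simp add: TT_def fun_eq_iff)
      moreover have "A.SB (bone Bh) ?\<Phi> = 0"
        by (simp add: A.bcomul_bone[OF b\<Phi>] \<delta>_one F0)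
      moreover have "A.SB (\<iota> b) ?\<Phi> = scale D c (A.SB (bone Bh) ?\<Phi>)"
        unfolding c lin_scale[OF A.lin_bcomul] by (rule sweedler_scale[OF b\<Phi> A.bcomul_tspace])
      ultimately show ?thesis
        using sweedler_eq[OF b\<Phi>, of 0 "[]"] bilin_dom(3)[OF F]
        by (simp add: tspace_zero lin_zero[OF lin_scale_right[OF lin_ident]])
    next
      fix n assume "n > 0" "\<iota> b \<in> grade Bh n"
      \<comment> \<open>Both terms subtracted in \<open>rD\<close> are killed by
        \<open>\<Phi>\<close>, because \<open>\<delta>\<close> vanishes on \<open>\<iota> b\<close>
        and on the unit.\<close>
      note eq = rD(2)[OF this]
      show ?thesis unfolding eq
        by (simp add: sweedler_minus[OF b\<Phi>] tspace_diff A.bcomul_tspace tens_in_tspace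
            sweedler_tens[OF b\<Phi>] \<delta>_\<iota> \<delta>_one F0)
    qed
    moreover have "A.SB (\<iota> b) ?\<Phi>
        = A.SB (\<iota> b) (\<lambda>u v. F (\<pi>E u) (\<pi>B v)) - A.SB (\<iota> b) (\<lambda>u v. F (l (\<pi>B u)) (\<pi>B v))"
      unfolding \<delta> sweedler_diff[symmetric]
      using F lin_diff[of E D "\<lambda>e. F e v" for v] by (simp add: bilin_def)
    moreover have "A.SB (\<iota> b) (\<lambda>u v. F (\<pi>E u) (\<pi>B v)) = SE (l b) F"
    proof -
      have "rho E (l b) = tmap Bh Bh E B \<pi>E \<pi>B (bcomul Bh (\<iota> b))" using assms(11) by (metis \<pi>E_\<iota>)
      then show ?thesis
        by (simp add: tmap_def sweedler_bind[OF F] tens_in_tspace sweedler_tens[OF F])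
    qed
    moreover have "A.SB (\<iota> b) (\<lambda>u v. F (l (\<pi>B u)) (\<pi>B v)) = SB b (\<lambda>x y. F (l x) y)"
    proof -
      have b2: "bilin B B D (\<lambda>x y. F (l x) y)"
        by (intro bilinI bilin_lin_left[OF F] bilin_lin_right[OF F] lin_ident vspace_B lin_l)
      have "bcomul B b = tmap Bh Bh B B \<pi>B \<pi>B (bcomul Bh (\<iota> b))"
        using homB unfolding graded_bhopf_hom_def by (metis \<pi>B_\<iota>)
      then show ?thesis
        by (simp add: tmap_def sweedler_bind[OF b2] tens_in_tspace sweedler_tens[OF b2])
    qed
    ultimately show ?thesis by simp
  qed

  \<comment> \<open>The hypotheses translated into statements about the defect of
    \<open>l\<close>\<close>
  have bt: "bilin E B TT (tens E B)" by (simp add: bilin_tens)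
  have bl: "bilin E B E (\<lambda>e c. scale E (\<epsilon>0 e) (l c))"
    by (intro lin_intros lin_compose[OF lin_\<epsilon>0] lin_compose[OF lin_l])
  have rD_tspace: "rD (\<iota> b) \<in> tspace Bh Bh" for b
    by (rule lin_in_subspace_on_basis[OF basis _ is_subspace_tspace])
      (use rD_\<iota>[OF _ bt] lin_compose[OF rD(1) lin_\<iota>] in auto)
  have X_\<iota>: "X (\<iota> b) = colinear_defect l b" for b
  proof (rule lin_eq_on_basis[OF basis])
    have "bilin Bh Bh TT (\<lambda>u v. tens E B (\<delta> u) (\<pi>B v))"
      by (intro bilinI bilin_lin_left[OF bt] bilin_lin_right[OF bt] lin_\<pi>B lin_\<delta>)
    then show "lin B TT (\<lambda>b. X (\<iota> b))"
      unfolding X tmap_def \<delta>_def[symmetric]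
      by (intro lin_sweedler_tensor lin_compose[OF rD(1)] lin_\<iota> rD_tspace)
    show "lin B TT (colinear_defect l)" by (rule lin_colinear_defect[OF lin_l])
    fix b assume b: "b \<in> BB"
    show "X (\<iota> b) = colinear_defect l b"
      unfolding X tmap_def \<delta>_def[symmetric] conjunct2[OF rD_\<iota>[OF b bt]]
      by (simp add: colinear_defect_def tmap_def sweedler_same rho_tspace)
  qed
  have \<epsilon>0l_rho: "\<epsilon>0l (rho E e) = l (slice \<epsilon>0 e)" for e
    by (simp add: \<epsilon>0l slice_def lin_sweedler[OF lin_l] lin_scale[OF lin_l])
  have lin_slice_l: "lin B B (\<lambda>b. slice \<epsilon>0 (l b) - b)"
    by (intro lin_intros lin_compose[OF lin_slice[OF lin_\<epsilon>0]] lin_compose[OF lin_l])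
  have bs: "bilin E B TT (\<lambda>e c. tens E B (l (slice \<epsilon>0 e)) c)"
    by (intro lin_intros lin_compose[OF lin_slice[OF lin_\<epsilon>0]] lin_compose[OF lin_l])
  have c1: "tmap E B E B (\<lambda>e. l (slice \<epsilon>0 e)) id (colinear_defect l b) = colinear_defect l b" for b
  proof (rule lin_eq_on_basis[OF basis])
    show "lin B TT (\<lambda>b. tmap E B E B (\<lambda>e. l (slice \<epsilon>0 e)) id (colinear_defect l b))"
      unfolding tmap_def id_apply
      by (intro lin_sweedler_tensor lin_colinear_defect lin_l colinear_defect_tspace bs)
    show "lin B TT (colinear_defect l)" by (rule lin_colinear_defect[OF lin_l])
    fix b assume "b \<in> BB"
    then show "tmap E B E B (\<lambda>e. l (slice \<epsilon>0 e)) id (colinear_defect l b) = colinear_defect l b"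
      using cond1 by (simp add: X_\<iota> \<epsilon>0l_rho)
  qed
  have c2: "colinear_defect l (slice \<epsilon>0 (l b) - b) = 0" for b
  proof (rule lin_eq_on_basis[OF basis, where C = TT and g = "\<lambda>_. 0"
        and f = "\<lambda>b. colinear_defect l (slice \<epsilon>0 (l b) - b)"])
    note ld = lin_colinear_defect[OF lin_l]
    show "lin B TT (\<lambda>b. colinear_defect l (slice \<epsilon>0 (l b) - b))"
      by (rule lin_compose[OF ld lin_slice_l])
    show "lin B TT (\<lambda>_. 0 :: ('k, 'e, 'b) tensor)"
      by (simp add: lin_iff vspace_TT) (simp add: TT_def fun_eq_iff)
    fix b assume b: "b \<in> BB"
    have bF: "bilin E B TT (\<lambda>e c. scale TT (\<epsilon>0 e) (colinear_defect l c))"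
      by (intro lin_intros lin_compose[OF lin_\<epsilon>0] lin_compose[OF ld])
    \<comment> \<open>By \<open>\<tau>1 = \<iota> \<pi>B\<close>, the inner
      \<open>X (\<tau>1 v)\<close> is the defect at \<open>\<pi>B v\<close>, so the second condition
      is \<open>rD_\<iota>\<close> for the form \<open>bF\<close>.\<close>
    have "0 = SE (l b) (\<lambda>e c. scale TT (\<epsilon>0 e) (colinear_defect l c))
        - SB b (\<lambda>x y. scale TT (\<epsilon>0 (l x)) (colinear_defect l y))"
      using cond2 b conjunct2[OF rD_\<iota>[OF b bF]] by (simp add: \<tau>1 X_\<iota> \<delta>_def)
    also have "\<dots> = colinear_defect l (slice \<epsilon>0 (l b)) - colinear_defect l b"
      unfolding \<epsilon>0_l bcounit_left[OF ld] slice_def lin_sweedler[OF ld] lin_scale[OF ld] ..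
    also have "\<dots> = colinear_defect l (slice \<epsilon>0 (l b) - b)" by (simp add: lin_diff[OF ld])
    finally show "colinear_defect l (slice \<epsilon>0 (l b) - b) = 0" by simp
  qed
  have \<omega>: "\<omega> b = l b - l (slice \<epsilon>0 (l b) - b)" for b
  proof (rule lin_eq_on_basis[OF basis assms(31)])
    show "lin B E (\<lambda>b. l b - l (slice \<epsilon>0 (l b) - b))"
      by (intro lin_sub lin_l lin_compose[OF lin_l] lin_slice_l)
    fix b assume "b \<in> BB"
    then have "\<omega> b = l b - \<epsilon>0l (colinear_defect l b)" using assms(32) by (simp add: X_\<iota>)
    \<comment> \<open>The map \<open>\<epsilon>0 \<otimes> l\<close> sends the defect to
      \<open>l n b\<close>, which identifies \<open>\<omega>\<close> with the corrected
      section.\<close>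
    also have "\<epsilon>0l (colinear_defect l b) = l (slice \<epsilon>0 (l b)) - l b"
      unfolding \<epsilon>0l sweedler_colinear_defect[OF bl] \<epsilon>0_l bcounit_left[OF lin_l]
      by (simp add: slice_def lin_sweedler[OF lin_l] lin_scale[OF lin_l])
    finally show "\<omega> b = l b - l (slice \<epsilon>0 (l b) - b)" by (simp add: lin_diff[OF lin_l])
  qed
  note \<omega>_props = colinear_correction[OF lin_l bij_l l_one lin_\<epsilon>0 \<epsilon>0_l c1 c2 \<omega>]
  \<comment> \<open>Cleftness supplies one invertible colinear bijection, from which invertibility
    passes to \<open>\<omega>\<close>.\<close>
  have "conv_invertible B E \<omega>"
    using cleft assms(31) \<omega>_props
    by (auto simp: cleft_object_def h_linear_def intro: colinear_iso_conv_invertible)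
  then obtain \<omega>' where "lin B E \<omega>'"
    "\<And>b. SB b (\<lambda>x y. cmul E (\<omega> x) (\<omega>' y)) = scale E (bcounit B b) (cone E)"
    "\<And>b. SB b (\<lambda>x y. cmul E (\<omega>' x) (\<omega> y)) = scale E (bcounit B b) (cone E)"
    by (auto simp: conv_invertible_def)
  then interpret C: cleaving H B E \<omega> \<omega>' \<epsilon>0
    using assms(34) \<omega>_props lin_\<epsilon>0 by unfold_locales auto
  have "\<sigma> = C.\<sigma>" by (intro ext) (simp add: \<sigma> C.\<sigma>_def)
  then show ?thesis using C.\<sigma>_in_Z2 C.iso_cocycle_twist by simp
qed

end
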